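(* Given a labeled poset $(P,\gamma)$, we have $$\mathcal E(P,\gamma)\simeq\bigoplus_{w\in\mathcal L(P)}\mathcal E(w,\gamma)$$ as a $\mathfrak{gl}_{\mathcal N}$-crystal. That is, for each composition $\alpha$, the multiplicity of $\mathbf B(\alpha)$ in $\mathcal E(P,\gamma)$ is equal to the number of $w\in\mathcal L(P)$ such that $\alpha(D(w,\gamma))=\alpha$.
   Context: $\mathcal N=\frac12\mathbb Z_{>0}$ with its usual linear order; elements of $\mathbb Z_{>0}$ are even, elements of $\frac12+\mathbb Z_{\ge0}$ are odd. $I=\frac12\mathbb Z_{>0}$. A labeled poset $(P,\gamma)$: $P=(X,<)$ is a finite set $X$ with $r$ elements and a partial order, $\gamma:X\to\mathbb Z_{>0}$ an injective map. An enriched $(P,\gamma)$-partition is a map $\sigma:X\to\mathcal N$ such that for all $x<y$ in $P$: (1) $\sigma(x)\le\sigma(y)$; (2) $\sigma(x)=\sigma(y)\in\mathbb Z_{>0}$ implies $\gamma(x)<\gamma(y)$; (3) $\sigma(x)=\sigma(y)\in\frac12+\mathbb Z_{\ge0}$ implies $\gamma(x)>\gamma(y)$. $\mathcal E(P,\gamma)$ is the set of these. $\mathcal L(P)$ is the set of linear extensions $w=\{w_1<\cdots<w_r\}$ of $P$ (total orders on $X$ extending the partial order); $\mathcal E(w,\gamma)$ is the set of enriched partitions of the labeled (totally ordered) poset $(w,\gamma)$, and $D(w,\gamma)=\{\,i\mid\gamma(w_i)>\gamma(w_{i+1})\,\}\subset\{1,\dots,r-1\}$. For $S=\{i_1<\cdots<i_s\}\subset\{1,\dots,r-1\}$,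 $\alpha(S)=(i_1,i_2-i_1,\dots,r-i_s)$, a composition of $r$ (the empty composition if $r=0$). Weights: $\bigoplus_{b\in\mathcal N}\mathbb Z\epsilon_b$ with $(\epsilon_a,\epsilon_b)=(-1)^{|a|}\delta_{ab}$ ($|a|$ the parity), simple roots $\alpha_i=\epsilon_i-\epsilon_{i+\frac12}$, $i\in I$. A $\mathfrak{gl}_{\mathcal N}$-crystal is a set $B$ with maps $\mathrm{wt}:B\to\bigoplus\mathbb Z\epsilon_b$, $\varepsilon_i,\varphi_i:B\to\mathbb Z_{\ge0}$, $e_i,f_i:B\to B\cup\{\mathbf 0\}$ ($\mathbf 0$ a formal symbol) such that: (1) $\varphi_i(b)+\varepsilon_i(b)$ is $1$ if $(\mathrm{wt}(b),\alpha_i)\ne0$ and $0$ otherwise; (2) if $e_ib\in B$ then $\varepsilon_i(e_ib)=\varepsilon_i(b)-1$, $\varphi_i(e_ib)=\varphi_i(b)+1$, $\mathrm{wt}(e_ib)=\mathrm{wt}(b)+\alpha_i$; (3) if $f_ib\in B$ then $\varepsilon_i(f_ib)=\varepsilon_i(b)+1$, $\varphi_i(f_ib)=\varphi_i(b)-1$, $\mathrm{wt}(f_ib)=\mathrm{wt}(b)-\alpha_i$; (4) $f_ib=b'$ iff $b=e_ib'$. It is viewed as an $I$-colored oriented graph ($b\xrightarrow{i}b'$ iff $b'=f_ib$). An isomorphism $\simeq$ of crystals is an isomorphism of colored oriented graphs preserving $\mathrm{wt},\varepsilon_i,\varphi_i$; $\bigoplus$ is disjoint union; the multiplicity of a connected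 crystal in $B$ is the number of connected components of $B$ isomorphic to it. Crystal of words: $\mathbf W$ is the set of finite words in $\mathcal N$ (including the empty word), $\mathrm{wt}(w_1\cdots w_r)=\sum_k\epsilon_{w_k}$. On letters, $f_i(i)=i+\frac12$, $e_i(i+\frac12)=i$, all other $e_i,f_i$ give $\mathbf 0$. On a word $w_1\cdots w_r$: for $i\in\mathbb Z_{>0}$ (resp. $i\in\frac12+\mathbb Z_{\ge0}$) let $k$ be the smallest (resp. largest) index with $w_k\in\{i,i+\frac12\}$; $e_i$, $f_i$ act by applying $e_i$, $f_i$ to $w_k$ ($\mathbf 0$ if that gives $\mathbf 0$); if no such $k$ exists, the result is $\mathbf 0$. $\varepsilon_i$ (resp. $\varphi_i$) is $1$ if $e_i$ (resp. $f_i$) does not give $\mathbf 0$, else $0$. $\mathcal E(P,\gamma)$ is a crystal via the embedding $\sigma\mapsto\sigma(x_1)\cdots\sigma(x_r)\in\mathbf W$, where $\gamma(x_1)>\cdots>\gamma(x_r)$ (its image is stable). A composition $\alpha=(\alpha_1,\dots,\alpha_t)$ is identified with its ribbon diagram: rows from top to bottom have $\alpha_1,\dots,\alpha_t$ nodes, and the leftmost node of row $i+1$ is directly below the rightmost node of row $i$. $\mathbf B(\alpha)$ is the set of quasi-ribbon tableaux of shape $\alpha$: fillings with entries in $\mathcal N$ weakly increasing along rows (left to right) and columns (top to bottom), with integers strictly increasing in each column and odd half-integers strictly increasing in each row. $\mathbf B(\alpha)$ is a (connected) crystal by identifying a tableau with its word in $\mathbf W$ obtained by reading rows top to bottom, each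 row right to left. *)

theory Defs
  imports Complex_Main "HOL-Library.Poly_Mapping" "HOL-Library.FuncSet" "HOL-Library.Extended_Nat"
begin

section \<open>The index set of positive half-integers\<close>

text \<open>The same type serves as the alphabet and as the set of colors, since both are the set of
  positive half-integers.\<close>

typedef half = "{q :: rat. 0 < q \<and> 2 * q \<in> \<int>}"
  morphisms rat_of_half Abs_half
  by (rule exI[of _ 1]) simp

setup_lifting type_definition_half

instantiation half :: linorder
begin

lift_definition less_eq_half :: "half \<Rightarrow> half \<Rightarrow> bool" is "(\<le>)" .

lift_definition less_half :: "half \<Rightarrow> half \<Rightarrow> bool" is "(<)" .

instance
  by standard (transfer; auto)+

end

lift_definition half_succ :: "half \<Rightarrow> half" is "\<lambda>q. q + 1/2"
  by (auto simp: algebra_simps)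

text \<open>An element is even if it is an integer and odd if it lies in \<open>1/2 + \<int>\<close>.\<close>

definition even_half :: "half \<Rightarrow> bool" where
  "even_half b \<longleftrightarrow> rat_of_half b \<in> \<int>"

abbreviation odd_half :: "half \<Rightarrow> bool" where
  "odd_half b \<equiv> \<not> even_half b"


section \<open>Weights and crystals\<close>

type_synonym weight = "half \<Rightarrow>\<^sub>0 int"

definition weight_eps :: "half \<Rightarrow> weight" where
  "weight_eps b = Poly_Mapping.single b 1"

text \<open>The bilinear form with \<open>(\<epsilon>\<^sub>a, \<epsilon>\<^sub>b) = (-1)^|a| \<delta>\<^sub>a\<^sub>b\<close>.\<close>

definition weight_form :: "weight \<Rightarrow> weight \<Rightarrow> int" where
  "weight_form l m =
     (\<Sum>b\<in>Poly_Mapping.keys l. (if even_half b then 1 else -1) * Poly_Mapping.lookup l b * Poly_Mapping.lookup m b)"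

definition simple_root :: "half \<Rightarrow> weight" where
  "simple_root i = weight_eps i - weight_eps (half_succ i)"

text \<open>\<open>None\<close> plays the role of the formal symbol \<open>0\<close>. Only the values of the structure maps at
  elements of the carrier matter.\<close>

record 'b crystal_data =
  carrier :: "'b set"
  wt :: "'b \<Rightarrow> weight"
  eps :: "half \<Rightarrow> 'b \<Rightarrow> nat"
  phi :: "half \<Rightarrow> 'b \<Rightarrow> nat"
  e_op :: "half \<Rightarrow> 'b \<Rightarrow> 'b option"
  f_op :: "half \<Rightarrow> 'b \<Rightarrow> 'b option"

definition gl_crystal :: "'b crystal_data \<Rightarrow> bool" where
  "gl_crystal B \<longleftrightarrow>
     (\<forall>i. \<forall>b\<in>carrier B.
        (\<forall>b'. e_op B i b = Some b' \<longrightarrow> b' \<in> carrier B) \<and>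
        (\<forall>b'. f_op B i b = Some b' \<longrightarrow> b' \<in> carrier B) \<and>
        phi B i b + eps B i b = (if weight_form (wt B b) (simple_root i) \<noteq> 0 then 1 else 0) \<and>
        (\<forall>b'. e_op B i b = Some b' \<longrightarrow>
           int (eps B i b') = int (eps B i b) - 1 \<and>
           int (phi B i b') = int (phi B i b) + 1 \<and>
           wt B b' = wt B b + simple_root i) \<and>
        (\<forall>b'. f_op B i b = Some b' \<longrightarrow>
           int (eps B i b') = int (eps B i b) + 1 \<and>
           int (phi B i b') = int (phi B i b) - 1 \<and>
           wt B b' = wt B b - simple_root i) \<and>
        (\<forall>b'\<in>carrier B. f_op B i b = Some b' \<longleftrightarrow> e_op B i b' = Some b))"

text \<open>Isomorphism of crystals: an isomorphism of the colored oriented graphs that preserves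
  \<open>wt\<close>, \<open>eps\<close> and \<open>phi\<close>. That both sides are crystals is part of the notion.\<close>

definition crystal_iso :: "'b crystal_data \<Rightarrow> 'c crystal_data \<Rightarrow> bool" (infix \<open>\<simeq>\<close> 50) where
  "B \<simeq> C \<longleftrightarrow> gl_crystal B \<and> gl_crystal C \<and>
     (\<exists>h. bij_betw h (carrier B) (carrier C) \<and>
        (\<forall>i. \<forall>b\<in>carrier B. \<forall>b'\<in>carrier B.
           f_op B i b = Some b' \<longleftrightarrow> f_op C i (h b) = Some (h b')) \<and>
        (\<forall>b\<in>carrier B. wt C (h b) = wt B b) \<and>
        (\<forall>i. \<forall>b\<in>carrier B. eps C i (h b) = eps B i b \<and> phi C i (h b) = phi B i b))"

definition crystal_sum :: "'k set \<Rightarrow> ('k \<Rightarrow> 'b crystal_data) \<Rightarrow> ('k \<times> 'b) crystal_data" where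
  "crystal_sum K B =
     \<lparr>carrier = (SIGMA k:K. carrier (B k)),
      wt = (\<lambda>(k, b). wt (B k) b),
      eps = (\<lambda>i (k, b). eps (B k) i b),
      phi = (\<lambda>i (k, b). phi (B k) i b),
      e_op = (\<lambda>i (k, b). map_option (Pair k) (e_op (B k) i b)),
      f_op = (\<lambda>i (k, b). map_option (Pair k) (f_op (B k) i b))\<rparr>"

definition crystal_edges :: "'b crystal_data \<Rightarrow> 'b rel" where
  "crystal_edges B =
     {(b, b'). b \<in> carrier B \<and> b' \<in> carrier B \<and> (\<exists>i. f_op B i b = Some b')}"

text \<open>Connected components of the underlying undirected graph, as crystals on subsets of the
  carrier.\<close>

definition crystal_components :: "'b crystal_data \<Rightarrow> 'b crystal_data set" where
  "crystal_components B =
     (\<lambda>C. B\<lparr>carrier := C\<rparr>) `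
       (carrier B // (crystal_edges B \<union> (crystal_edges B)\<inverse>)\<^sup>*)"

text \<open>The multiplicity of a connected crystal \<open>C\<close> in \<open>B\<close>; it takes the value \<open>\<infinity>\<close> if there are
  infinitely many components isomorphic to \<open>C\<close>.\<close>

definition multiplicity :: "'c crystal_data \<Rightarrow> 'b crystal_data \<Rightarrow> enat" where
  "multiplicity C B =
     (let M = {K \<in> crystal_components B. K \<simeq> C}
      in if finite M then enat (card M) else \<infinity>)"


section \<open>The crystal of words\<close>

definition letter_e :: "half \<Rightarrow> half \<Rightarrow> half option" where
  "letter_e i a = (if a = half_succ i then Some i else None)"

definition letter_f :: "half \<Rightarrow> half \<Rightarrow> half option" where
  "letter_f i a = (if a = i then Some (half_succ i) else None)"

definition i_positions :: "half \<Rightarrow> half list \<Rightarrow> nat set" where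
  "i_positions i u = {k. k < length u \<and> u ! k \<in> {i, half_succ i}}"

definition word_op :: "(half \<Rightarrow> half \<Rightarrow> half option) \<Rightarrow> half \<Rightarrow> half list \<Rightarrow> half list option" where
  "word_op g i u =
     (if i_positions i u = {} then None
      else let k = (if even_half i then Min (i_positions i u) else Max (i_positions i u))
           in map_option (\<lambda>c. u[k := c]) (g i (u ! k)))"

definition word_crystal :: "half list crystal_data" where
  "word_crystal =
     \<lparr>carrier = UNIV,
      wt = (\<lambda>u. \<Sum>a\<leftarrow>u. weight_eps a),
      eps = (\<lambda>i u. if word_op letter_e i u \<noteq> None then 1 else 0),
      phi = (\<lambda>i u. if word_op letter_f i u \<noteq> None then 1 else 0),
      e_op = word_op letter_e,
      f_op = word_op letter_f\<rparr>"

text \<open>The crystal structure on a set \<open>S\<close> induced by an injective reading map \<open>rd\<close> from \<open>S\<close> to words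
  whose image is stable under the operators.\<close>

definition induced_crystal :: "'b set \<Rightarrow> ('b \<Rightarrow> half list) \<Rightarrow> 'b crystal_data" where
  "induced_crystal S rd =
     \<lparr>carrier = S,
      wt = (\<lambda>b. wt word_crystal (rd b)),
      eps = (\<lambda>i b. eps word_crystal i (rd b)),
      phi = (\<lambda>i b. phi word_crystal i (rd b)),
      e_op = (\<lambda>i b. map_option (inv_into S rd) (e_op word_crystal i (rd b))),
      f_op = (\<lambda>i b. map_option (inv_into S rd) (f_op word_crystal i (rd b)))\<rparr>"


section \<open>Enriched partitions of labeled posets\<close>

text \<open>A partial order on \<open>X\<close> is given by its reflexive relation \<open>r\<close>.\<close>

definition labeled_poset :: "'a set \<Rightarrow> 'a rel \<Rightarrow> ('a \<Rightarrow> nat) \<Rightarrow> bool" where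
  "labeled_poset X r \<gamma> \<longleftrightarrow>
     finite X \<and> partial_order_on X r \<and> inj_on \<gamma> X \<and> (\<forall>x\<in>X. 0 < \<gamma> x)"

definition enriched_partitions :: "'a set \<Rightarrow> 'a rel \<Rightarrow> ('a \<Rightarrow> nat) \<Rightarrow> ('a \<Rightarrow> half) set" where
  "enriched_partitions X r \<gamma> =
     {\<sigma> \<in> X \<rightarrow>\<^sub>E UNIV. \<forall>x y. (x, y) \<in> r \<and> x \<noteq> y \<longrightarrow>
        \<sigma> x \<le> \<sigma> y \<and>
        (\<sigma> x = \<sigma> y \<and> even_half (\<sigma> x) \<longrightarrow> \<gamma> x < \<gamma> y) \<and>
        (\<sigma> x = \<sigma> y \<and> odd_half (\<sigma> x) \<longrightarrow> \<gamma> x > \<gamma> y)}"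

text \<open>The elements of \<open>X\<close> are read by decreasing label.\<close>

definition partition_word :: "'a set \<Rightarrow> ('a \<Rightarrow> nat) \<Rightarrow> ('a \<Rightarrow> half) \<Rightarrow> half list" where
  "partition_word X \<gamma> \<sigma> = map \<sigma> (rev (sorted_key_list_of_set \<gamma> X))"

definition enriched_crystal :: "'a set \<Rightarrow> 'a rel \<Rightarrow> ('a \<Rightarrow> nat) \<Rightarrow> ('a \<Rightarrow> half) crystal_data" where
  "enriched_crystal X r \<gamma> =
     induced_crystal (enriched_partitions X r \<gamma>) (partition_word X \<gamma>)"

definition linear_extensions :: "'a set \<Rightarrow> 'a rel \<Rightarrow> 'a rel set" where
  "linear_extensions X r = {w. linear_order_on X w \<and> r \<subseteq> w}"

definition order_list :: "'a set \<Rightarrow> 'a rel \<Rightarrow> 'a list" where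
  "order_list X w = (THE xs. distinct xs \<and> set xs = X \<and> sorted_wrt (\<lambda>x y. (x, y) \<in> w) xs)"

text \<open>Positions in \<open>w = {w\<^sub>1 < \<dots> < w\<^sub>r}\<close> start at 1, positions in lists at 0.\<close>

definition descents :: "'a set \<Rightarrow> 'a rel \<Rightarrow> ('a \<Rightarrow> nat) \<Rightarrow> nat set" where
  "descents X w \<gamma> =
     {i. 1 \<le> i \<and> i < card X \<and> \<gamma> (order_list X w ! (i - 1)) > \<gamma> (order_list X w ! i)}"


section \<open>Compositions and quasi-ribbon tableaux\<close>

definition composition :: "nat list \<Rightarrow> bool" where
  "composition \<alpha> \<longleftrightarrow> (\<forall>k\<in>set \<alpha>. 0 < k)"

text \<open>The composition \<open>(i\<^sub>1, i\<^sub>2 - i\<^sub>1, \<dots>, r - i\<^sub>s)\<close> of \<open>r\<close> for \<open>S = {i\<^sub>1 < \<dots> < i\<^sub>s}\<close>.\<close>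

definition composition_of :: "nat \<Rightarrow> nat set \<Rightarrow> nat list" where
  "composition_of r S =
     (if r = 0 then []
      else map2 (\<lambda>a b. b - a) (0 # sorted_list_of_set S) (sorted_list_of_set S @ [r]))"

text \<open>Nodes are pairs (row, column), both numbered from 0, with rows going down and columns going
  right. As consecutive rows overlap in exactly one column, row \<open>i\<close> starts in column
  \<open>\<Sum>k<i. (\<alpha>\<^sub>k - 1)\<close>.\<close>

definition row_start :: "nat list \<Rightarrow> nat \<Rightarrow> nat" where
  "row_start \<alpha> i = (\<Sum>k<i. \<alpha> ! k - 1)"

definition ribbon :: "nat list \<Rightarrow> (nat \<times> nat) set" where
  "ribbon \<alpha> = {(i, j). i < length \<alpha> \<and> row_start \<alpha> i \<le> j \<and> j < row_start \<alpha> i + \<alpha> ! i}"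

definition quasi_ribbon_tableaux :: "nat list \<Rightarrow> (nat \<times> nat \<Rightarrow> half) set" where
  "quasi_ribbon_tableaux \<alpha> =
     {T \<in> ribbon \<alpha> \<rightarrow>\<^sub>E UNIV.
        (\<forall>i j j'. (i, j) \<in> ribbon \<alpha> \<and> (i, j') \<in> ribbon \<alpha> \<and> j < j' \<longrightarrow>
           T (i, j) \<le> T (i, j') \<and> (odd_half (T (i, j)) \<longrightarrow> T (i, j) < T (i, j'))) \<and>
        (\<forall>i i' j. (i, j) \<in> ribbon \<alpha> \<and> (i', j) \<in> ribbon \<alpha> \<and> i < i' \<longrightarrow>
           T (i, j) \<le> T (i', j) \<and> (even_half (T (i, j)) \<longrightarrow> T (i, j) < T (i', j)))}"

text \<open>Rows from top to bottom, each row from right to left.\<close>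

definition tableau_word :: "nat list \<Rightarrow> (nat \<times> nat \<Rightarrow> half) \<Rightarrow> half list" where
  "tableau_word \<alpha> T =
     concat (map (\<lambda>i. map (\<lambda>j. T (i, j)) (rev [row_start \<alpha> i ..< row_start \<alpha> i + \<alpha> ! i]))
       [0..<length \<alpha>])"

definition quasi_ribbon_crystal :: "nat list \<Rightarrow> (nat \<times> nat \<Rightarrow> half) crystal_data" where
  "quasi_ribbon_crystal \<alpha> = induced_crystal (quasi_ribbon_tableaux \<alpha>) (tableau_word \<alpha>)"

end

theory Submission
  imports Defs "HOL-Library.Multiset"
begin

text \<open>
  Every enriched partition \<open>\<sigma>\<close> of \<open>(P, \<gamma>)\<close> is compatible with exactly one linear extension: order
  the elements by \<open>\<sigma>\<close>, breaking ties by increasing label at even values and by decreasing label at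
  odd values. The operators act by the same rule on the enriched partitions of \<open>P\<close> and of its linear
  extensions and preserve all of these sets; this gives the decomposition.

  For a linear extension \<open>w\<close> an enriched partition amounts to its sequence of values along \<open>w\<close>, and
  there is an \<open>i\<close>-arrow from \<open>\<sigma>\<close> to \<open>\<tau>\<close> iff \<open>\<tau>\<close> arises by raising a single value \<open>i\<close> to
  \<open>i + 1/2\<close>, no matter which one. So the crystal depends only on the length and the descent set.
  It is connected, since every sequence can be lowered to the pointwise least one, and conversely
  it determines the length and the descent set, since a weakly increasing sequence is determined by
  its weight. Quasi-ribbon tableaux are the enriched partitions of the ribbon, ordered
  componentwise and labeled against the reading order.
\<close>

section \<open>Half-integers and the crystal of words\<close>

text \<open>One letter rule fits every order because \<open>i\<close> and \<open>half_succ i\<close>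
  have opposite parities, so that the tie-breaking by labels reverses between them. The extremal
  label picked by the operators therefore belongs to the last element of value \<open>i\<close>, if
  it has that value, and to the first element of value \<open>half_succ i\<close> otherwise. Moving
  this element across the boundary leaves the sorted order of all elements unchanged. On a chain the
  converse holds too: an element that can be raised from \<open>i\<close> without breaking the order
  must be the picked one. This is what removes the labels from the description of the arrows,
  although chains with equal descents can have different reading words.

  A formal obstacle remains: the operators of an induced crystal go through \<open>inv_into\<close>
  on its own carrier, so two such crystals are compared only at elements of a common carrier and not
  as records.\<close>

lift_definition half_of_nat :: "nat \<Rightarrow> half" is "\<lambda>n. of_nat (Suc n) / 2"
proof -
  fix n
  have "2 * (of_nat (Suc n) / 2 :: rat) = of_nat (Suc n)"
    by simp
  also have "\<dots> \<in> \<int>"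
    by (rule Ints_of_nat)
  finally show "0 < (of_nat (Suc n) / 2 :: rat) \<and> 2 * (of_nat (Suc n) / 2 :: rat) \<in> \<int>"
    by simp
qed

lemma half_of_nat_less_iff [simp]: "half_of_nat m < half_of_nat n \<longleftrightarrow> m < n"
  by transfer auto

lemma half_of_nat_le_iff [simp]: "half_of_nat m \<le> half_of_nat n \<longleftrightarrow> m \<le> n"
  by transfer auto

lemma half_of_nat_eq_iff [simp]: "half_of_nat m = half_of_nat n \<longleftrightarrow> m = n"
  by transfer auto

lemma half_succ_half_of_nat [simp]: "half_succ (half_of_nat n) = half_of_nat (Suc n)"
  by transfer (auto simp: field_simps)

text \<open>\<open>half_of_nat n\<close> is (n + 1)/2, shifted so that index 0 is the least letter
  1/2. Hence the integers are the letters of odd index.\<close>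

lemma even_half_half_of_nat [simp]: "even_half (half_of_nat n) \<longleftrightarrow> odd n"
proof -
  have "rat_of_half (half_of_nat n) = of_nat (Suc n) / 2"
    by transfer simp
  moreover have "(of_nat (Suc n) / 2 :: rat) \<in> \<int> \<longleftrightarrow> even (Suc n)"
  proof
    assume "(of_nat (Suc n) / 2 :: rat) \<in> \<int>"
    then obtain z where "(of_nat (Suc n) / 2 :: rat) = of_int z"
      by (auto elim: Ints_cases)
    then have "(of_int (int (Suc n)) :: rat) = of_int (2 * z)"
      by (simp add: field_simps)
    then have "int (Suc n) = 2 * z"
      by (simp only: of_int_eq_iff)
    then show "even (Suc n)"
      by presburger
  next
    assume "even (Suc n)"
    then obtain k where "Suc n = 2 * k" ..
    then show "(of_nat (Suc n) / 2 :: rat) \<in> \<int>"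
      by simp
  qed
  ultimately show ?thesis
    unfolding even_half_def by (metis even_Suc)
qed

lemma half_cases [cases type: half]:
  obtains n where "b = half_of_nat n"
proof -
  have "\<exists>n. b = half_of_nat n"
  proof transfer
    fix b :: rat
    assume b: "0 < b \<and> 2 * b \<in> \<int>"
    then obtain z where z: "2 * b = of_int z"
      by (auto elim: Ints_cases)
    with b have "0 < z"
      by (metis mult_pos_pos of_int_0_less_iff zero_less_numeral)
    then obtain n where "z = int (Suc n)"
      by (metis gr0_implies_Suc zero_less_imp_eq_int)
    with z have "b = of_nat (Suc n) / 2"
      by simp
    then show "\<exists>n. b = of_nat (Suc n) / 2" ..
  qed
  with that show ?thesis
    by blast
qed

lemma less_half_succ [simp]: "b < half_succ b"
  by (cases b) simp

lemma half_succ_neq [simp]: "half_succ b \<noteq> b" "b \<noteq> half_succ b"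
  by (metis less_half_succ less_irrefl)+

lemma half_succ_le_iff: "half_succ a \<le> b \<longleftrightarrow> a < b"
  by (cases a; cases b) auto

lemma even_half_half_succ [simp]: "even_half (half_succ b) \<longleftrightarrow> odd_half b"
  by (cases b) auto

section \<open>The operators on words\<close>

lemma finite_i_positions [simp]: "finite (i_positions i u)"
  by (simp add: i_positions_def)

text \<open>The position chosen in \<open>word_op\<close>; it does not involve the letter function,
  so \<open>e\<close> and \<open>f\<close> share it.\<close>

definition active_position :: "half \<Rightarrow> half list \<Rightarrow> nat" where
  "active_position i u = (if even_half i then Min (i_positions i u) else Max (i_positions i u))"

lemma active_position_in: "i_positions i u \<noteq> {} \<Longrightarrow> active_position i u \<in> i_positions i u"
  by (auto simp: active_position_def)

lemma word_op_eq_Some_iff: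
  "word_op g i u = Some v \<longleftrightarrow>
     (i_positions i u \<noteq> {} \<and> (\<exists>c. g i (u ! active_position i u) = Some c \<and> v = u[active_position i u := c]))"
  by (auto simp: word_op_def active_position_def Let_def)

lemma word_f_eq_Some_iff:
  "word_op letter_f i u = Some v \<longleftrightarrow>
     (i_positions i u \<noteq> {} \<and> u ! active_position i u = i \<and> v = u[active_position i u := half_succ i])"
  by (auto simp: word_op_eq_Some_iff letter_f_def)

lemma word_e_eq_Some_iff:
  "word_op letter_e i u = Some v \<longleftrightarrow>
     (i_positions i u \<noteq> {} \<and> u ! active_position i u = half_succ i \<and> v = u[active_position i u := i])"
  by (auto simp: word_op_eq_Some_iff letter_e_def)

lemma i_positions_list_update:
  assumes "k \<in> i_positions i u" "c \<in> {i, half_succ i}"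
  shows "i_positions i (u[k := c]) = i_positions i u"
  using assms by (auto simp: i_positions_def nth_list_update)

text \<open>An operator only exchanges \<open>i\<close> and \<open>half_succ i\<close> at the active
  position. The candidate positions stay the same, so the opposite operator picks the same position
  and undoes the change.\<close>

lemma word_f_iff_word_e:
  "word_op letter_f i u = Some v \<longleftrightarrow> word_op letter_e i v = Some u"
proof
  assume "word_op letter_f i u = Some v"
  then have *: "i_positions i u \<noteq> {}" "u ! active_position i u = i"
      "v = u[active_position i u := half_succ i]"
    by (auto simp: word_f_eq_Some_iff)
  from *(1) have k: "active_position i u \<in> i_positions i u"
    by (rule active_position_in)
  have "i_positions i v = i_positions i u"
    unfolding *(3) by (rule i_positions_list_update[OF k]) simp
  moreover from this have "active_position i v = active_position i u"
    by (simp add: active_position_def)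
  moreover have "u[active_position i u := i] = u"
    using *(2) by (metis list_update_id)
  ultimately show "word_op letter_e i v = Some u"
    using * k by (simp add: word_e_eq_Some_iff i_positions_def)
next
  assume "word_op letter_e i v = Some u"
  then have *: "i_positions i v \<noteq> {}" "v ! active_position i v = half_succ i"
      "u = v[active_position i v := i]"
    by (auto simp: word_e_eq_Some_iff)
  from *(1) have k: "active_position i v \<in> i_positions i v"
    by (rule active_position_in)
  have "i_positions i u = i_positions i v"
    unfolding *(3) by (rule i_positions_list_update[OF k]) simp
  moreover from this have "active_position i u = active_position i v"
    by (simp add: active_position_def)
  moreover have "v[active_position i v := half_succ i] = v"
    using *(2) by (metis list_update_id)
  ultimately show "word_op letter_f i u = Some v"
    using * k by (simp add: word_f_eq_Some_iff i_positions_def)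
qed

lemma word_f_ne_None_iff:
  "word_op letter_f i u \<noteq> None \<longleftrightarrow> i_positions i u \<noteq> {} \<and> u ! active_position i u = i"
  using word_f_eq_Some_iff by blast

lemma word_e_ne_None_iff:
  "word_op letter_e i u \<noteq> None \<longleftrightarrow> i_positions i u \<noteq> {} \<and> u ! active_position i u = half_succ i"
  using word_e_eq_Some_iff by blast

section \<open>Weights of words and the crystal axioms for words\<close>

definition word_weight :: "half list \<Rightarrow> weight" where
  "word_weight u = (\<Sum>a\<leftarrow>u. weight_eps a)"

lemma word_weight_simps [simp]:
  "word_weight [] = 0" "word_weight (a # u) = weight_eps a + word_weight u"
  by (simp_all add: word_weight_def)

lemma lookup_word_weight: "Poly_Mapping.lookup (word_weight u) b = int (count_list u b)"
  by (induction u) (auto simp: lookup_add weight_eps_def lookup_single when_def)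

text \<open>A summand vanishes unless its index is a key of both weights, so the sum over the keys
  of the first argument may be moved to any finite set containing the keys of the second. For a
  simple root this set has two elements.\<close>

lemma weight_form_eq_sum:
  assumes "finite A" "Poly_Mapping.keys m \<subseteq> A"
  shows "weight_form l m =
    (\<Sum>b\<in>A. (if even_half b then 1 else -1) * Poly_Mapping.lookup l b * Poly_Mapping.lookup m b)"
proof -
  have "weight_form l m = (\<Sum>b\<in>Poly_Mapping.keys l \<union> A.
     (if even_half b then 1 else -1) * Poly_Mapping.lookup l b * Poly_Mapping.lookup m b)"
    unfolding weight_form_def using assms
    by (intro sum.mono_neutral_left) (auto simp: in_keys_iff)
  also have "\<dots> = (\<Sum>b\<in>A. (if even_half b then 1 else -1) * Poly_Mapping.lookup l b * Poly_Mapping.lookup m b)"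
    using assms by (intro sum.mono_neutral_right) (auto simp: in_keys_iff)
  finally show ?thesis .
qed

text \<open>The parities of \<open>i\<close> and \<open>half_succ i\<close> differ, so the sign of
  the form absorbs the minus sign of the simple root and leaves a sum. For a word this is a sum of
  two letter counts, in which nothing can cancel.\<close>

lemma weight_form_simple_root:
  "weight_form l (simple_root i) =
     (if even_half i then 1 else -1) * (Poly_Mapping.lookup l i + Poly_Mapping.lookup l (half_succ i))"
proof -
  have "Poly_Mapping.keys (simple_root i) \<subseteq> {i, half_succ i}"
    by (auto simp: simple_root_def in_keys_iff lookup_minus weight_eps_def lookup_single when_def
        split: if_splits)
  then have "weight_form l (simple_root i) =
    (\<Sum>b\<in>{i, half_succ i}. (if even_half b then 1 else -1) * Poly_Mapping.lookup l b *
       Poly_Mapping.lookup (simple_root i) b)"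
    by (intro weight_form_eq_sum) auto
  then show ?thesis
    by (simp add: simple_root_def lookup_minus weight_eps_def lookup_single)
qed

lemma i_positions_eq_empty_iff: "i_positions i u = {} \<longleftrightarrow> i \<notin> set u \<and> half_succ i \<notin> set u"
  by (auto simp: i_positions_def in_set_conv_nth)

lemma weight_form_word_weight_simple_root:
  "weight_form (word_weight u) (simple_root i) \<noteq> 0 \<longleftrightarrow> i_positions i u \<noteq> {}"
proof -
  have "int (count_list u i) + int (count_list u (half_succ i)) = 0 \<longleftrightarrow> i_positions i u = {}"
    using count_list_0_iff[of u i] count_list_0_iff[of u "half_succ i"]
    by (auto simp: i_positions_eq_empty_iff)
  then show ?thesis
    by (simp add: weight_form_simple_root lookup_word_weight)
qed

lemma word_weight_list_update:
  "k < length u \<Longrightarrow> word_weight (u[k := c]) = word_weight u - weight_eps (u ! k) + weight_eps c"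
  by (induction u arbitrary: k) (auto split: nat.split simp: nth_Cons algebra_simps)

lemma word_crystal_simps:
  "carrier word_crystal = UNIV"
  "wt word_crystal = word_weight"
  "eps word_crystal i u = (if word_op letter_e i u \<noteq> None then 1 else 0)"
  "phi word_crystal i u = (if word_op letter_f i u \<noteq> None then 1 else 0)"
  "e_op word_crystal = word_op letter_e"
  "f_op word_crystal = word_op letter_f"
  by (auto simp: word_crystal_def word_weight_def fun_eq_iff)

lemma word_f_Some_eps_phi:
  assumes "word_op letter_f i u = Some v"
  shows "word_op letter_e i u = None" "word_op letter_f i v = None" "word_op letter_e i v = Some u"
    "word_weight v = word_weight u - simple_root i"
proof -
  show e: "word_op letter_e i v = Some u"
    using assms word_f_iff_word_e by blast
  from assms show "word_op letter_e i u = None"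
    using word_f_ne_None_iff[of i u] word_e_ne_None_iff[of i u] by auto
  from e show "word_op letter_f i v = None"
    using word_f_ne_None_iff[of i v] word_e_ne_None_iff[of i v] by auto
  from assms have *: "i_positions i u \<noteq> {}" "u ! active_position i u = i"
      "v = u[active_position i u := half_succ i]"
    by (auto simp: word_f_eq_Some_iff)
  then have "active_position i u < length u"
    using active_position_in[of i u] by (simp add: i_positions_def)
  with * show "word_weight v = word_weight u - simple_root i"
    by (simp add: word_weight_list_update simple_root_def)
qed

lemma gl_crystal_word_crystal: "gl_crystal word_crystal"
  unfolding gl_crystal_def word_crystal_simps
proof (intro allI ballI conjI impI UNIV_I)
  fix i u
  \<comment> \<open>The active letter is \<open>i\<close> or \<open>half_succ i\<close>, so exactly
    one of the two operators is defined as soon as there is a candidate position.\<close>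
  have "i_positions i u \<noteq> {} \<Longrightarrow> u ! active_position i u \<in> {i, half_succ i}"
    using active_position_in[of i u] by (auto simp: i_positions_def)
  then show "(if word_op letter_f i u \<noteq> None then 1 else 0) + (if word_op letter_e i u \<noteq> None then 1 else 0) =
    (if weight_form (word_weight u) (simple_root i) \<noteq> 0 then 1 else (0::nat))"
    unfolding weight_form_word_weight_simple_root word_f_ne_None_iff word_e_ne_None_iff
    by auto
next
  fix i u v
  show "word_op letter_f i u = Some v \<longleftrightarrow> word_op letter_e i v = Some u"
    by (rule word_f_iff_word_e)
  show "int (if word_op letter_e i v \<noteq> None then 1 else 0) =
      int (if word_op letter_e i u \<noteq> None then 1 else 0) + 1"
    "int (if word_op letter_f i v \<noteq> None then 1 else 0) =
      int (if word_op letter_f i u \<noteq> None then 1 else 0) - 1"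
    "word_weight v = word_weight u - simple_root i"
    if "word_op letter_f i u = Some v"
    using word_f_Some_eps_phi[OF that] that by simp_all
  show "int (if word_op letter_e i v \<noteq> None then 1 else 0) =
      int (if word_op letter_e i u \<noteq> None then 1 else 0) - 1"
    "int (if word_op letter_f i v \<noteq> None then 1 else 0) =
      int (if word_op letter_f i u \<noteq> None then 1 else 0) + 1"
    "word_weight v = word_weight u + simple_root i"
    if "word_op letter_e i u = Some v"
    using word_f_Some_eps_phi[of i v u] that word_f_iff_word_e[of i v u] by simp_all
qed

section \<open>Crystals induced by a reading map\<close>

lemma induced_crystal_simps:
  "carrier (induced_crystal S rd) = S"
  "wt (induced_crystal S rd) b = word_weight (rd b)"
  "eps (induced_crystal S rd) i b = (if word_op letter_e i (rd b) \<noteq> None then 1 else 0)"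
  "phi (induced_crystal S rd) i b = (if word_op letter_f i (rd b) \<noteq> None then 1 else 0)"
  "e_op (induced_crystal S rd) i b = map_option (inv_into S rd) (word_op letter_e i (rd b))"
  "f_op (induced_crystal S rd) i b = map_option (inv_into S rd) (word_op letter_f i (rd b))"
  by (simp_all add: induced_crystal_def word_crystal_simps)

text \<open>Stability of the image guarantees that \<open>inv_into\<close> is applied only to words
  that are read from an element of \<open>S\<close>, where it is a true inverse.\<close>

lemma induced_crystal_op_iff:
  assumes "inj_on rd S" "\<And>v. word_op g i (rd b) = Some v \<Longrightarrow> v \<in> rd ` S"
  shows "map_option (inv_into S rd) (word_op g i (rd b)) = Some b' \<longleftrightarrow>
    b' \<in> S \<and> word_op g i (rd b) = Some (rd b')"
  using assms by (auto simp: inv_into_f_f f_inv_into_f inv_into_into)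

lemma gl_crystal_induced_crystal:
  assumes inj: "inj_on rd S"
    and e: "\<And>i b v. b \<in> S \<Longrightarrow> word_op letter_e i (rd b) = Some v \<Longrightarrow> v \<in> rd ` S"
    and f: "\<And>i b v. b \<in> S \<Longrightarrow> word_op letter_f i (rd b) = Some v \<Longrightarrow> v \<in> rd ` S"
  shows "gl_crystal (induced_crystal S rd)"
proof -
  have ops: "e_op (induced_crystal S rd) i b = Some b' \<longleftrightarrow> b' \<in> S \<and> e_op word_crystal i (rd b) = Some (rd b')"
    "f_op (induced_crystal S rd) i b = Some b' \<longleftrightarrow> b' \<in> S \<and> f_op word_crystal i (rd b) = Some (rd b')"
    if "b \<in> S" for i b b'
    unfolding induced_crystal_simps word_crystal_simps
    by (rule induced_crystal_op_iff[OF inj e[OF that]] induced_crystal_op_iff[OF inj f[OF that]]; assumption)+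
  have simps: "carrier (induced_crystal S rd) = S"
    "wt (induced_crystal S rd) b = wt word_crystal (rd b)"
    "eps (induced_crystal S rd) i b = eps word_crystal i (rd b)"
    "phi (induced_crystal S rd) i b = phi word_crystal i (rd b)" for i b
    by (simp_all add: induced_crystal_def)
  have W: "\<forall>i. \<forall>b.
        phi word_crystal i b + eps word_crystal i b =
          (if weight_form (wt word_crystal b) (simple_root i) \<noteq> 0 then 1 else 0) \<and>
        (\<forall>b'. e_op word_crystal i b = Some b' \<longrightarrow>
           int (eps word_crystal i b') = int (eps word_crystal i b) - 1 \<and>
           int (phi word_crystal i b') = int (phi word_crystal i b) + 1 \<and>
           wt word_crystal b' = wt word_crystal b + simple_root i) \<and>
        (\<forall>b'. f_op word_crystal i b = Some b' \<longrightarrow>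
           int (eps word_crystal i b') = int (eps word_crystal i b) + 1 \<and>
           int (phi word_crystal i b') = int (phi word_crystal i b) - 1 \<and>
           wt word_crystal b' = wt word_crystal b - simple_root i) \<and>
        (\<forall>b'. f_op word_crystal i b = Some b' \<longleftrightarrow> e_op word_crystal i b' = Some b)"
    using gl_crystal_word_crystal unfolding gl_crystal_def word_crystal_simps(1) by blast
  show ?thesis
    unfolding gl_crystal_def simps
    using W by (auto simp: ops)
qed

section \<open>The operators on enriched partitions\<close>

definition enriched_less :: "('a \<Rightarrow> nat) \<Rightarrow> ('a \<Rightarrow> half) \<Rightarrow> 'a \<Rightarrow> 'a \<Rightarrow> bool" where
  "enriched_less \<gamma> \<sigma> x y \<longleftrightarrow>
     \<sigma> x < \<sigma> y \<or> \<sigma> x = \<sigma> y \<and> (if even_half (\<sigma> x) then \<gamma> x < \<gamma> y else \<gamma> y < \<gamma> x)"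

lemma enriched_less_irrefl [simp]: "\<not> enriched_less \<gamma> \<sigma> x x"
  by (simp add: enriched_less_def)

lemma enriched_less_trans: "enriched_less \<gamma> \<sigma> x y \<Longrightarrow> enriched_less \<gamma> \<sigma> y z \<Longrightarrow> enriched_less \<gamma> \<sigma> x z"
  by (auto simp: enriched_less_def split: if_splits)

lemma enriched_less_total:
  "\<gamma> x \<noteq> \<gamma> y \<Longrightarrow> enriched_less \<gamma> \<sigma> x y \<or> enriched_less \<gamma> \<sigma> y x"
  by (auto simp: enriched_less_def)

text \<open>The three conditions on a related pair are one comparison in the order that sorts by
  value and breaks ties by label. This order is transitive and compares any two elements with
  different labels.\<close>

lemma mem_enriched_partitions_iff:
  "\<sigma> \<in> enriched_partitions X r \<gamma> \<longleftrightarrow>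
     \<sigma> \<in> X \<rightarrow>\<^sub>E UNIV \<and> (\<forall>x y. (x, y) \<in> r \<and> x \<noteq> y \<longrightarrow> enriched_less \<gamma> \<sigma> x y)"
  unfolding enriched_partitions_def enriched_less_def mem_Collect_eq
  by (intro conj_cong refl all_cong1 imp_cong) (auto simp: le_less)

section \<open>Enumerating a finite set by a key that is injective on it\<close>

lemma (in linorder) sorted_key_list_of_set_inj_on:
  assumes "finite X" "inj_on f X"
  shows "set (sorted_key_list_of_set f X) = X" "sorted_wrt (<) (map f (sorted_key_list_of_set f X))"
proof -
  interpret folding_insort_key "(\<le>)" "(<)" X f
    by unfold_locales (rule assms)
  show "set (sorted_key_list_of_set f X) = X" "sorted_wrt (<) (map f (sorted_key_list_of_set f X))"
    using assms by simp_all
qed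

lemma (in linorder) sorted_key_list_of_set_unique_inj_on:
  assumes "sorted_wrt (<) (map f xs)"
  shows "sorted_key_list_of_set f (set xs) = xs"
proof -
  have *: "sorted (map f xs)" "distinct (map f xs)"
    using assms by (simp_all add: strict_sorted_iff)
  interpret folding_insort_key "(\<le>)" "(<)" "set xs" f
    by unfold_locales (use * in \<open>simp add: distinct_map\<close>)
  show ?thesis
    using * by (intro idem_if_sorted_distinct) (auto simp: distinct_map)
qed
definition reading_list :: "'a set \<Rightarrow> ('a \<Rightarrow> nat) \<Rightarrow> 'a list" where
  "reading_list X \<gamma> = rev (sorted_key_list_of_set \<gamma> X)"

lemma partition_word_reading_list: "partition_word X \<gamma> \<sigma> = map \<sigma> (reading_list X \<gamma>)"
  by (simp add: partition_word_def reading_list_def)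

lemma reading_list:
  assumes "finite X" "inj_on \<gamma> X"
  shows "set (reading_list X \<gamma>) = X" "distinct (reading_list X \<gamma>)"
    "sorted_wrt (\<lambda>x y. \<gamma> y < \<gamma> x) (reading_list X \<gamma>)"
  using sorted_key_list_of_set_inj_on[OF assms]
  by (simp_all add: reading_list_def sorted_wrt_rev flip: sorted_wrt_map)
    (auto simp: strict_sorted_iff distinct_map)

lemma reading_list_unique:
  assumes "set ys = X" "sorted_wrt (\<lambda>x y. \<gamma> y < \<gamma> x) ys"
  shows "reading_list X \<gamma> = ys"
  using sorted_key_list_of_set_unique_inj_on[of \<gamma> "rev ys"] assms
  by (simp add: reading_list_def sorted_wrt_rev sorted_wrt_map)

lemma partition_word_inj_on:
  assumes "finite X" "inj_on \<gamma> X" "S \<subseteq> X \<rightarrow>\<^sub>E UNIV"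
  shows "inj_on (partition_word X \<gamma>) S"
proof (rule inj_onI)
  fix \<sigma> \<tau>
  assume "\<sigma> \<in> S" "\<tau> \<in> S" "partition_word X \<gamma> \<sigma> = partition_word X \<gamma> \<tau>"
  then have "\<forall>x\<in>X. \<sigma> x = \<tau> x"
    using reading_list(1)[OF assms(1,2)] by (simp add: partition_word_reading_list)
  with \<open>\<sigma> \<in> S\<close> \<open>\<tau> \<in> S\<close> show "\<sigma> = \<tau>"
    using assms(3) by (metis PiE_ext subsetD)
qed

text \<open>The element on which the operators \<open>e\<^sub>i\<close> and \<open>f\<^sub>i\<close> act.\<close>

definition active :: "'a set \<Rightarrow> ('a \<Rightarrow> nat) \<Rightarrow> ('a \<Rightarrow> half) \<Rightarrow> half \<Rightarrow> 'a \<Rightarrow> bool" where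
  "active X \<gamma> \<sigma> i x \<longleftrightarrow> x \<in> X \<and> \<sigma> x \<in> {i, half_succ i} \<and>
     (\<forall>y\<in>X. \<sigma> y \<in> {i, half_succ i} \<longrightarrow> (if even_half i then \<gamma> y \<le> \<gamma> x else \<gamma> x \<le> \<gamma> y))"

lemma active_unique: "inj_on \<gamma> X \<Longrightarrow> active X \<gamma> \<sigma> i x \<Longrightarrow> active X \<gamma> \<sigma> i y \<Longrightarrow> x = y"
  unfolding active_def by (metis inj_onD order_antisym)

lemma active_imp_nonempty:
  assumes "finite X" "inj_on \<gamma> X" "active X \<gamma> \<sigma> i x"
  shows "i_positions i (partition_word X \<gamma> \<sigma>) \<noteq> {}"
proof -
  have "\<sigma> x \<in> set (partition_word X \<gamma> \<sigma>)"
    using assms(3) reading_list(1)[OF assms(1,2)]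
    by (simp add: partition_word_reading_list active_def)
  then show ?thesis
    using assms(3) by (auto simp: i_positions_eq_empty_iff active_def)
qed

text \<open>Labels decrease along the reading list, so the least candidate position carries the
  largest label and the greatest position the smallest. This translates the even and odd cases of
  the word rule.\<close>

lemma active_position_active:
  assumes "finite X" "inj_on \<gamma> X" "i_positions i (partition_word X \<gamma> \<sigma>) \<noteq> {}"
  defines "k \<equiv> active_position i (partition_word X \<gamma> \<sigma>)"
  shows "k < length (reading_list X \<gamma>)" "active X \<gamma> \<sigma> i (reading_list X \<gamma> ! k)"
proof -
  let ?ys = "reading_list X \<gamma>"
  have k: "k \<in> i_positions i (partition_word X \<gamma> \<sigma>)"
    unfolding k_def by (rule active_position_in[OF assms(3)])
  then show len: "k < length ?ys"
    by (simp add: i_positions_def partition_word_reading_list)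
  note ys = reading_list[OF assms(1,2)]
  show "active X \<gamma> \<sigma> i (?ys ! k)"
    unfolding active_def
  proof (intro conjI ballI impI)
    show "?ys ! k \<in> X"
      using ys(1) len by (metis nth_mem)
    show "\<sigma> (?ys ! k) \<in> {i, half_succ i}"
      using k len by (simp add: i_positions_def partition_word_reading_list)
    fix y
    assume "y \<in> X" and y: "\<sigma> y \<in> {i, half_succ i}"
    then obtain l where l: "l < length ?ys" "y = ?ys ! l"
      using ys(1) by (metis in_set_conv_nth)
    with y have "l \<in> i_positions i (partition_word X \<gamma> \<sigma>)"
      by (simp add: i_positions_def partition_word_reading_list)
    then have "if even_half i then k \<le> l else l \<le> k"
      by (simp add: k_def active_position_def)
    moreover have "\<gamma> (?ys ! q) \<le> \<gamma> (?ys ! p)" if "p \<le> q" "q < length ?ys" for p q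
      using sorted_wrt_nth_less[OF ys(3), of p q] that by (cases "p = q") auto
    ultimately show "if even_half i then \<gamma> y \<le> \<gamma> (?ys ! k) else \<gamma> (?ys ! k) \<le> \<gamma> y"
      using l len by (auto split: if_splits)
  qed
qed

text \<open>Moves the operators from positions of words to elements of \<open>X\<close>. No partial
  order occurs here, which is why a poset and its linear extensions have the same operators.\<close>

lemma word_op_partition_word:
  assumes "finite X" "inj_on \<gamma> X"
  shows "word_op g i (partition_word X \<gamma> \<sigma>) = Some v \<longleftrightarrow>
    (\<exists>x c. active X \<gamma> \<sigma> i x \<and> g i (\<sigma> x) = Some c \<and> v = partition_word X \<gamma> (\<sigma>(x := c)))"
proof (cases "i_positions i (partition_word X \<gamma> \<sigma>) = {}")
  case True
  then show ?thesis
    using active_imp_nonempty[OF assms] by (auto simp: word_op_eq_Some_iff)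
next
  case False
  define k where "k = active_position i (partition_word X \<gamma> \<sigma>)"
  note k = active_position_active[OF assms False, folded k_def]
  have eq: "(partition_word X \<gamma> \<sigma>)[k := c] = partition_word X \<gamma> (\<sigma>(reading_list X \<gamma> ! k := c))" for c
    using k(1) reading_list(2)[OF assms]
    by (intro nth_equalityI)
      (auto simp: partition_word_reading_list nth_list_update nth_eq_iff_index_eq)
  have nth: "partition_word X \<gamma> \<sigma> ! k = \<sigma> (reading_list X \<gamma> ! k)"
    using k(1) by (simp add: partition_word_reading_list)
  have "active X \<gamma> \<sigma> i x \<longleftrightarrow> x = reading_list X \<gamma> ! k" for x
    using k(2) active_unique[OF assms(2)] by blast
  then show ?thesis
    using False by (simp add: word_op_eq_Some_iff eq nth flip: k_def)
qed

text \<open>The label of \<open>x\<close> is extremal among the values \<open>i\<close> and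
  \<open>half_succ i\<close>, in the direction that comes last at \<open>i\<close> and first at
  \<open>half_succ i\<close>. An element \<open>z\<close> after \<open>x\<close> within this band
  thus has value \<open>half_succ i\<close> and still follows \<open>x\<close> for either choice of
  \<open>c\<close>.\<close>

lemma enriched_less_update_left:
  assumes "enriched_less \<gamma> \<sigma> x z" "x \<noteq> z" "\<gamma> x \<noteq> \<gamma> z"
    and x: "\<sigma> x = i \<or> \<sigma> x = half_succ i" and c: "c = i \<or> c = half_succ i"
    and z: "\<sigma> z = i \<or> \<sigma> z = half_succ i \<Longrightarrow> if even_half i then \<gamma> z \<le> \<gamma> x else \<gamma> x \<le> \<gamma> z"
  shows "enriched_less \<gamma> (\<sigma>(x := c)) x z"
proof (cases "half_succ i < \<sigma> z")
  case True
  then have "c < \<sigma> z"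
    using c less_half_succ[of i] by (metis order_less_trans)
  then show ?thesis
    using assms(2) by (simp add: enriched_less_def)
next
  case False
  have "i \<le> \<sigma> x" "\<sigma> x \<le> \<sigma> z"
    using assms(1) x less_imp_le[OF less_half_succ[of i]] by (auto simp: enriched_less_def)
  with False have *: "\<sigma> z = i \<or> \<sigma> z = half_succ i"
    using half_succ_le_iff[of i "\<sigma> z"] by (metis not_less_iff_gr_or_eq order_antisym_conv order_trans not_le_imp_less)
  have gz: "even_half i \<Longrightarrow> \<gamma> z < \<gamma> x" "odd_half i \<Longrightarrow> \<gamma> x < \<gamma> z"
    using z[OF *] assms(3) by (auto split: if_splits)
  \<comment> \<open>Otherwise both values are \<open>i\<close>, and the extremal label of
    \<open>x\<close> would place \<open>z\<close> before \<open>x\<close>.\<close>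
  have "\<sigma> z = half_succ i"
  proof (rule ccontr)
    assume "\<sigma> z \<noteq> half_succ i"
    with * \<open>\<sigma> x \<le> \<sigma> z\<close> x have "\<sigma> z = i" "\<sigma> x = i"
      using less_half_succ[of i] by (auto simp: not_le[symmetric] simp del: less_half_succ)
    with assms(1) gz show False
      by (auto simp: enriched_less_def split: if_splits)
  qed
  with c gz assms(2) show ?thesis
    by (cases "even_half i") (auto simp: enriched_less_def)
qed

text \<open>The mirror image: an element before \<open>x\<close> within the band has value
  \<open>i\<close>, because at \<open>half_succ i\<close> the element \<open>x\<close> comes
  first.\<close>

lemma enriched_less_update_right:
  assumes "enriched_less \<gamma> \<sigma> y x" "x \<noteq> y" "\<gamma> x \<noteq> \<gamma> y"
    and x: "\<sigma> x = i \<or> \<sigma> x = half_succ i" and c: "c = i \<or> c = half_succ i"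
    and y: "\<sigma> y = i \<or> \<sigma> y = half_succ i \<Longrightarrow> if even_half i then \<gamma> y \<le> \<gamma> x else \<gamma> x \<le> \<gamma> y"
  shows "enriched_less \<gamma> (\<sigma>(x := c)) y x"
proof (cases "\<sigma> y < i")
  case True
  then have "\<sigma> y < c"
    using c less_half_succ[of i] by (metis order_less_trans)
  then show ?thesis
    using assms(2) by (simp add: enriched_less_def)
next
  case False
  have "\<sigma> x \<le> half_succ i" "\<sigma> y \<le> \<sigma> x"
    using assms(1) x less_imp_le[OF less_half_succ[of i]] by (auto simp: enriched_less_def)
  with False have *: "\<sigma> y = i \<or> \<sigma> y = half_succ i"
    using half_succ_le_iff[of i "\<sigma> y"] by (metis not_less_iff_gr_or_eq order_antisym_conv order_trans not_le_imp_less)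
  have gz: "even_half i \<Longrightarrow> \<gamma> y < \<gamma> x" "odd_half i \<Longrightarrow> \<gamma> x < \<gamma> y"
    using y[OF *] assms(3) by (auto split: if_splits)
  have "\<sigma> y = i"
  proof (rule ccontr)
    assume "\<sigma> y \<noteq> i"
    with * \<open>\<sigma> y \<le> \<sigma> x\<close> x have "\<sigma> y = half_succ i" "\<sigma> x = half_succ i"
      using less_half_succ[of i] by (auto simp: not_le[symmetric] simp del: less_half_succ)
    with assms(1) gz show False
      by (auto simp: enriched_less_def split: if_splits)
  qed
  with c gz assms(2) show ?thesis
    by (cases "even_half i") (auto simp: enriched_less_def)
qed

text \<open>Only pairs that contain \<open>x\<close> are affected, and they fall under the two
  preceding lemmas. Allowing both values of \<open>c\<close> covers \<open>e\<close> and
  \<open>f\<close> together.\<close>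

lemma active_update_enriched:
  assumes P: "labeled_poset X r \<gamma>" and \<sigma>: "\<sigma> \<in> enriched_partitions X r \<gamma>"
    and x: "active X \<gamma> \<sigma> i x" and c: "c \<in> {i, half_succ i}"
  shows "\<sigma>(x := c) \<in> enriched_partitions X r \<gamma>"
  unfolding mem_enriched_partitions_iff
proof (intro conjI allI impI)
  from \<sigma> x show "\<sigma>(x := c) \<in> X \<rightarrow>\<^sub>E UNIV"
    by (auto simp: mem_enriched_partitions_iff active_def PiE_iff extensional_def)
  fix y z
  assume yz: "(y, z) \<in> r \<and> y \<noteq> z"
  with P have X: "y \<in> X" "z \<in> X" "\<gamma> y \<noteq> \<gamma> z"
    by (auto simp: labeled_poset_def partial_order_on_def preorder_on_def inj_on_def)
  from \<sigma> yz have less: "enriched_less \<gamma> \<sigma> y z"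
    by (auto simp: mem_enriched_partitions_iff)
  have x': "\<sigma> x = i \<or> \<sigma> x = half_succ i" "c = i \<or> c = half_succ i"
    using x c by (auto simp: active_def)
  have max: "if even_half i then \<gamma> w \<le> \<gamma> x else \<gamma> x \<le> \<gamma> w"
    if "w \<in> X" "\<sigma> w = i \<or> \<sigma> w = half_succ i" for w
    using x that by (auto simp: active_def)
  consider "y = x" | "z = x" | "y \<noteq> x" "z \<noteq> x"
    by blast
  then show "enriched_less \<gamma> (\<sigma>(x := c)) y z"
  proof cases
    case 1
    have "enriched_less \<gamma> (\<sigma>(x := c)) x z"
      using less x' 1 max[of z] X yz by (intro enriched_less_update_left) auto
    with 1 show ?thesis
      by simp
  next
    case 2
    have "enriched_less \<gamma> (\<sigma>(x := c)) y x"
      using less x' 2 max[of y] X yz by (intro enriched_less_update_right) auto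
    with 2 show ?thesis
      by simp
  next
    case 3
    with less show ?thesis
      by (simp add: enriched_less_def)
  qed
qed

lemma enriched_word_op_stable:
  assumes P: "labeled_poset X r \<gamma>" and \<sigma>: "\<sigma> \<in> enriched_partitions X r \<gamma>"
    and g: "\<And>a c. g i a = Some c \<Longrightarrow> c \<in> {i, half_succ i}"
    and v: "word_op g i (partition_word X \<gamma> \<sigma>) = Some v"
  shows "v \<in> partition_word X \<gamma> ` enriched_partitions X r \<gamma>"
proof -
  have "finite X" "inj_on \<gamma> X"
    using P by (auto simp: labeled_poset_def)
  with v obtain x c where "active X \<gamma> \<sigma> i x" "g i (\<sigma> x) = Some c" "v = partition_word X \<gamma> (\<sigma>(x := c))"
    by (auto simp: word_op_partition_word)
  then show ?thesis
    using active_update_enriched[OF P \<sigma>] g by blast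
qed

lemma letter_f_range: "letter_f i a = Some c \<Longrightarrow> c \<in> {i, half_succ i}"
  by (simp add: letter_f_def split: if_splits)

lemma letter_e_range: "letter_e i a = Some c \<Longrightarrow> c \<in> {i, half_succ i}"
  by (simp add: letter_e_def split: if_splits)

lemma inj_on_partition_word_enriched:
  "labeled_poset X r \<gamma> \<Longrightarrow> inj_on (partition_word X \<gamma>) (enriched_partitions X r \<gamma>)"
  by (rule partition_word_inj_on) (auto simp: labeled_poset_def enriched_partitions_def)

lemma gl_crystal_enriched_crystal:
  assumes P: "labeled_poset X r \<gamma>"
  shows "gl_crystal (enriched_crystal X r \<gamma>)"
  unfolding enriched_crystal_def
  by (rule gl_crystal_induced_crystal inj_on_partition_word_enriched enriched_word_op_stable P
      letter_e_range letter_f_range | assumption)+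

lemma enriched_crystal_op:
  assumes P: "labeled_poset X r \<gamma>" and \<sigma>: "\<sigma> \<in> enriched_partitions X r \<gamma>"
    and g: "\<And>a c. g i a = Some c \<Longrightarrow> c \<in> {i, half_succ i}"
  shows "map_option (inv_into (enriched_partitions X r \<gamma>) (partition_word X \<gamma>))
      (word_op g i (partition_word X \<gamma> \<sigma>)) = Some \<tau> \<longleftrightarrow>
    (\<exists>x c. active X \<gamma> \<sigma> i x \<and> g i (\<sigma> x) = Some c \<and> \<tau> = \<sigma>(x := c))"
proof -
  have fin: "finite X" "inj_on \<gamma> X"
    using P by (auto simp: labeled_poset_def)
  note inj = inj_on_partition_word_enriched[OF P]
  have "map_option (inv_into (enriched_partitions X r \<gamma>) (partition_word X \<gamma>))
      (word_op g i (partition_word X \<gamma> \<sigma>)) = Some \<tau> \<longleftrightarrow>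
    \<tau> \<in> enriched_partitions X r \<gamma> \<and> word_op g i (partition_word X \<gamma> \<sigma>) = Some (partition_word X \<gamma> \<tau>)"
    by (rule induced_crystal_op_iff[OF inj enriched_word_op_stable[OF P \<sigma> g]])
  also have "\<dots> \<longleftrightarrow> (\<exists>x c. active X \<gamma> \<sigma> i x \<and> g i (\<sigma> x) = Some c \<and>
      \<tau> \<in> enriched_partitions X r \<gamma> \<and> partition_word X \<gamma> \<tau> = partition_word X \<gamma> (\<sigma>(x := c)))"
    by (auto simp: word_op_partition_word[OF fin])
  also have "\<dots> \<longleftrightarrow> (\<exists>x c. active X \<gamma> \<sigma> i x \<and> g i (\<sigma> x) = Some c \<and> \<tau> = \<sigma>(x := c))"
    using active_update_enriched[OF P \<sigma>] g inj_onD[OF inj] by metis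
  finally show ?thesis .
qed

lemma enriched_crystal_simps:
  "carrier (enriched_crystal X r \<gamma>) = enriched_partitions X r \<gamma>"
  "wt (enriched_crystal X r \<gamma>) \<sigma> = word_weight (partition_word X \<gamma> \<sigma>)"
  by (simp_all add: enriched_crystal_def induced_crystal_simps)

lemma enriched_crystal_f:
  assumes "labeled_poset X r \<gamma>" "\<sigma> \<in> enriched_partitions X r \<gamma>"
  shows "f_op (enriched_crystal X r \<gamma>) i \<sigma> = Some \<tau> \<longleftrightarrow>
    (\<exists>x. active X \<gamma> \<sigma> i x \<and> \<sigma> x = i \<and> \<tau> = \<sigma>(x := half_succ i))"
  using enriched_crystal_op[OF assms, of letter_f i \<tau>, OF letter_f_range]
  by (auto simp: enriched_crystal_def induced_crystal_simps letter_f_def)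

lemma enriched_crystal_e:
  assumes "labeled_poset X r \<gamma>" "\<sigma> \<in> enriched_partitions X r \<gamma>"
  shows "e_op (enriched_crystal X r \<gamma>) i \<sigma> = Some \<tau> \<longleftrightarrow>
    (\<exists>x. active X \<gamma> \<sigma> i x \<and> \<sigma> x = half_succ i \<and> \<tau> = \<sigma>(x := i))"
  using enriched_crystal_op[OF assms, of letter_e i \<tau>, OF letter_e_range]
  by (auto simp: enriched_crystal_def induced_crystal_simps letter_e_def)

lemma enriched_crystal_eps_phi:
  "eps (enriched_crystal X r \<gamma>) i \<sigma> = (if e_op (enriched_crystal X r \<gamma>) i \<sigma> \<noteq> None then 1 else 0)"
  "phi (enriched_crystal X r \<gamma>) i \<sigma> = (if f_op (enriched_crystal X r \<gamma>) i \<sigma> \<noteq> None then 1 else 0)"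
  by (simp_all add: enriched_crystal_def induced_crystal_simps)

section \<open>Decomposition along linear extensions\<close>

definition sorting_order :: "'a set \<Rightarrow> ('a \<Rightarrow> nat) \<Rightarrow> ('a \<Rightarrow> half) \<Rightarrow> 'a rel" where
  "sorting_order X \<gamma> \<sigma> = {(x, y) \<in> X \<times> X. x = y \<or> enriched_less \<gamma> \<sigma> x y}"

lemma linear_order_on_sorting_order:
  assumes "inj_on \<gamma> X"
  shows "linear_order_on X (sorting_order X \<gamma> \<sigma>)"
  unfolding linear_order_on_def partial_order_on_def preorder_on_def
proof (intro conjI)
  show "sorting_order X \<gamma> \<sigma> \<subseteq> X \<times> X" "refl_on X (sorting_order X \<gamma> \<sigma>)"
    by (auto simp: sorting_order_def refl_on_def)
  show "trans (sorting_order X \<gamma> \<sigma>)"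
    by (rule transI) (auto simp: sorting_order_def intro: enriched_less_trans)
  show "antisym (sorting_order X \<gamma> \<sigma>)"
    by (rule antisymI) (use enriched_less_trans enriched_less_irrefl in \<open>fastforce simp: sorting_order_def\<close>)
  show "total_on X (sorting_order X \<gamma> \<sigma>)"
    unfolding total_on_def sorting_order_def
    using inj_onD[OF assms] enriched_less_total[of \<gamma>] by blast
qed

lemma sorting_order_in_linear_extensions:
  assumes "labeled_poset X r \<gamma>" "\<sigma> \<in> enriched_partitions X r \<gamma>"
  shows "sorting_order X \<gamma> \<sigma> \<in> linear_extensions X r"
  using assms linear_order_on_sorting_order[of \<gamma> X \<sigma>]
  by (fastforce simp: linear_extensions_def mem_enriched_partitions_iff sorting_order_def
      labeled_poset_def partial_order_on_def preorder_on_def)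

lemma enriched_sorting_order:
  "\<sigma> \<in> X \<rightarrow>\<^sub>E UNIV \<Longrightarrow> \<sigma> \<in> enriched_partitions X (sorting_order X \<gamma> \<sigma>) \<gamma>"
  by (auto simp: mem_enriched_partitions_iff sorting_order_def)

text \<open>Totality leaves no room for a proper extension: a pair of \<open>w\<close> missing from
  \<open>v\<close> has its reverse in \<open>v\<close>, hence in \<open>w\<close>, against
  antisymmetry.\<close>

lemma linear_order_eqI:
  assumes "linear_order_on X v" "linear_order_on X w" "v \<subseteq> w"
  shows "v = w"
proof
  show "w \<subseteq> v"
  proof (rule subrelI)
    fix x y
    assume xy: "(x, y) \<in> w"
    with assms have X: "x \<in> X" "y \<in> X"
      by (auto simp: linear_order_on_def partial_order_on_def preorder_on_def)
    consider "x = y" | "(x, y) \<in> v" | "(y, x) \<in> v" "x \<noteq> y"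
      using assms(1) X by (auto simp: linear_order_on_def total_on_def)
    then show "(x, y) \<in> v"
    proof cases
      case 1
      then show ?thesis
        using assms(1) X by (auto simp: linear_order_on_def partial_order_on_def preorder_on_def refl_on_def)
    next
      case 3
      then show ?thesis
        using assms(2,3) xy by (auto simp: linear_order_on_def partial_order_on_def antisym_def)
    qed
  qed
qed (rule assms)

lemma sorting_order_unique:
  assumes "inj_on \<gamma> X" "linear_order_on X w" "\<sigma> \<in> enriched_partitions X w \<gamma>"
  shows "sorting_order X \<gamma> \<sigma> = w"
proof (rule sym, rule linear_order_eqI[OF assms(2) linear_order_on_sorting_order[OF assms(1)]])
  show "w \<subseteq> sorting_order X \<gamma> \<sigma>"
    using assms by (auto simp: mem_enriched_partitions_iff sorting_order_def linear_order_on_def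
        partial_order_on_def preorder_on_def)
qed

lemma linear_extensions_labeled_poset:
  assumes "labeled_poset X r \<gamma>" "w \<in> linear_extensions X r"
  shows "linear_order_on X w" "labeled_poset X w \<gamma>"
  using assms by (auto simp: linear_extensions_def labeled_poset_def linear_order_on_def)

lemma enriched_partitions_mono:
  "r \<subseteq> w \<Longrightarrow> enriched_partitions X w \<gamma> \<subseteq> enriched_partitions X r \<gamma>"
  unfolding mem_enriched_partitions_iff subset_iff by blast

text \<open>The decomposition on the level of sets: the pieces of distinct linear extensions are
  disjoint, they exhaust the enriched partitions of the poset, and \<open>sorting_order\<close>
  names the piece to which \<sigma> belongs.\<close>

lemma enriched_partitions_linear_extension_iff:
  assumes P: "labeled_poset X r \<gamma>"
  shows "w \<in> linear_extensions X r \<and> \<sigma> \<in> enriched_partitions X w \<gamma> \<longleftrightarrow>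
    \<sigma> \<in> enriched_partitions X r \<gamma> \<and> w = sorting_order X \<gamma> \<sigma>"
proof (intro iffI conjI)
  assume w: "w \<in> linear_extensions X r \<and> \<sigma> \<in> enriched_partitions X w \<gamma>"
  then show "\<sigma> \<in> enriched_partitions X r \<gamma>"
    using enriched_partitions_mono[of r w X \<gamma>] by (auto simp: linear_extensions_def)
  show "w = sorting_order X \<gamma> \<sigma>"
    using sorting_order_unique[of \<gamma> X w \<sigma>] w P
    by (auto simp: linear_extensions_def labeled_poset_def)
next
  assume \<sigma>: "\<sigma> \<in> enriched_partitions X r \<gamma> \<and> w = sorting_order X \<gamma> \<sigma>"
  then show "w \<in> linear_extensions X r"
    using sorting_order_in_linear_extensions[OF P] by blast
  show "\<sigma> \<in> enriched_partitions X w \<gamma>"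
    using \<sigma> enriched_sorting_order[of \<sigma> X \<gamma>] by (auto simp: mem_enriched_partitions_iff)
qed

text \<open>Both sides are described by \<open>active\<close>, which sees \<open>X\<close>, \<gamma>
  and \<sigma> but not the order. The element \<sigma> has to lie in the piece of \<open>w\<close>,
  since each side inverts the reading map on its own carrier.\<close>

lemma enriched_crystal_linear_extension_f:
  assumes P: "labeled_poset X r \<gamma>" and w: "w \<in> linear_extensions X r"
    and \<sigma>: "\<sigma> \<in> enriched_partitions X w \<gamma>"
  shows "f_op (enriched_crystal X w \<gamma>) i \<sigma> = f_op (enriched_crystal X r \<gamma>) i \<sigma>"
    and "e_op (enriched_crystal X w \<gamma>) i \<sigma> = e_op (enriched_crystal X r \<gamma>) i \<sigma>"
proof -
  have \<sigma>': "\<sigma> \<in> enriched_partitions X r \<gamma>"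
    using enriched_partitions_linear_extension_iff[OF P] w \<sigma> by blast
  note w' = linear_extensions_labeled_poset(2)[OF P w]
  show "f_op (enriched_crystal X w \<gamma>) i \<sigma> = f_op (enriched_crystal X r \<gamma>) i \<sigma>"
    by (metis enriched_crystal_f[OF P \<sigma>'] enriched_crystal_f[OF w' \<sigma>] not_Some_eq)
  show "e_op (enriched_crystal X w \<gamma>) i \<sigma> = e_op (enriched_crystal X r \<gamma>) i \<sigma>"
    by (metis enriched_crystal_e[OF P \<sigma>'] enriched_crystal_e[OF w' \<sigma>] not_Some_eq)
qed

lemma gl_crystalD:
  assumes "gl_crystal B" "b \<in> carrier B"
  shows "e_op B i b = Some b' \<Longrightarrow> b' \<in> carrier B"
    "f_op B i b = Some b' \<Longrightarrow> b' \<in> carrier B"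
    "phi B i b + eps B i b = (if weight_form (wt B b) (simple_root i) \<noteq> 0 then 1 else 0)"
    "e_op B i b = Some b' \<Longrightarrow> int (eps B i b') = int (eps B i b) - 1 \<and>
       int (phi B i b') = int (phi B i b) + 1 \<and> wt B b' = wt B b + simple_root i"
    "f_op B i b = Some b' \<Longrightarrow> int (eps B i b') = int (eps B i b) + 1 \<and>
       int (phi B i b') = int (phi B i b) - 1 \<and> wt B b' = wt B b - simple_root i"
    "b' \<in> carrier B \<Longrightarrow> f_op B i b = Some b' \<longleftrightarrow> e_op B i b' = Some b"
  using assms(1)[unfolded gl_crystal_def, THEN spec, THEN bspec, OF assms(2), of i] by blast+

lemma gl_crystalI:
  assumes "\<And>i b b'. b \<in> carrier B \<Longrightarrow> e_op B i b = Some b' \<Longrightarrow> b' \<in> carrier B"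
    "\<And>i b b'. b \<in> carrier B \<Longrightarrow> f_op B i b = Some b' \<Longrightarrow> b' \<in> carrier B"
    "\<And>i b. b \<in> carrier B \<Longrightarrow>
       phi B i b + eps B i b = (if weight_form (wt B b) (simple_root i) \<noteq> 0 then 1 else 0)"
    "\<And>i b b'. b \<in> carrier B \<Longrightarrow> e_op B i b = Some b' \<Longrightarrow> int (eps B i b') = int (eps B i b) - 1 \<and>
       int (phi B i b') = int (phi B i b) + 1 \<and> wt B b' = wt B b + simple_root i"
    "\<And>i b b'. b \<in> carrier B \<Longrightarrow> f_op B i b = Some b' \<Longrightarrow> int (eps B i b') = int (eps B i b) + 1 \<and>
       int (phi B i b') = int (phi B i b) - 1 \<and> wt B b' = wt B b - simple_root i"
    "\<And>i b b'. b \<in> carrier B \<Longrightarrow> b' \<in> carrier B \<Longrightarrow> f_op B i b = Some b' \<longleftrightarrow> e_op B i b' = Some b"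
  shows "gl_crystal B"
  unfolding gl_crystal_def by (intro allI ballI conjI impI; (elim conjE)?; use assms in blast)

lemma gl_crystal_crystal_sum:
  assumes "\<And>k. k \<in> K \<Longrightarrow> gl_crystal (B k)"
  shows "gl_crystal (crystal_sum K B)"
proof -
  let ?S = "crystal_sum K B"
  have eqs: "(k, b) \<in> carrier ?S \<longleftrightarrow> k \<in> K \<and> b \<in> carrier (B k)"
    "wt ?S (k, b) = wt (B k) b"
    "eps ?S i (k, b) = eps (B k) i b"
    "phi ?S i (k, b) = phi (B k) i b"
    "e_op ?S i (k, b) = Some (k', b') \<longleftrightarrow> k' = k \<and> e_op (B k) i b = Some b'"
    "f_op ?S i (k, b) = Some (k', b') \<longleftrightarrow> k' = k \<and> f_op (B k) i b = Some b'"
    for i k b k' b'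
    by (auto simp: crystal_sum_def)
  show ?thesis
  proof (rule gl_crystalI, unfold split_paired_all eqs)
  qed (metis gl_crystalD[OF assms])+
qed

text \<open>The piece containing \<sigma> is a crystal of its own, hence closed under its operator,
  and this operator agrees with that of the poset. So no arrow leaves a piece.\<close>

lemma sorting_order_f:
  assumes P: "labeled_poset X r \<gamma>"
    and \<sigma>: "\<sigma> \<in> enriched_partitions X r \<gamma>" and f: "f_op (enriched_crystal X r \<gamma>) i \<sigma> = Some \<tau>"
  shows "sorting_order X \<gamma> \<tau> = sorting_order X \<gamma> \<sigma>"
proof -
  let ?w = "sorting_order X \<gamma> \<sigma>"
  note iff = enriched_partitions_linear_extension_iff[OF P]
  have w: "?w \<in> linear_extensions X r" "\<sigma> \<in> enriched_partitions X ?w \<gamma>"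
    using iff \<sigma> by blast+
  have "gl_crystal (enriched_crystal X ?w \<gamma>)"
    by (intro gl_crystal_enriched_crystal linear_extensions_labeled_poset(2)[OF P] w)
  moreover have "f_op (enriched_crystal X ?w \<gamma>) i \<sigma> = Some \<tau>"
    using enriched_crystal_linear_extension_f[OF P w] f by simp
  ultimately have "\<tau> \<in> enriched_partitions X ?w \<gamma>"
    using gl_crystalD(2) w(2) by (metis enriched_crystal_simps(1))
  with w(1) show ?thesis
    using iff by blast
qed

lemma enriched_crystal_iso_crystal_sum:
  assumes P: "labeled_poset X r \<gamma>"
  shows "enriched_crystal X r \<gamma> \<simeq>
    crystal_sum (linear_extensions X r) (\<lambda>w. enriched_crystal X w \<gamma>)"
  unfolding crystal_iso_def
proof (intro conjI exI)
  let ?L = "linear_extensions X r" and ?E = "enriched_crystal X r \<gamma>"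
  let ?S = "crystal_sum ?L (\<lambda>w. enriched_crystal X w \<gamma>)"
  let ?h = "\<lambda>\<sigma>. (sorting_order X \<gamma> \<sigma>, \<sigma>)"
  note iff = enriched_partitions_linear_extension_iff[OF P]
  show "gl_crystal ?E"
    by (rule gl_crystal_enriched_crystal[OF P])
  show "gl_crystal ?S"
    using linear_extensions_labeled_poset(2)[OF P]
    by (intro gl_crystal_crystal_sum gl_crystal_enriched_crystal)
  have S: "carrier ?S = (SIGMA w:?L. enriched_partitions X w \<gamma>)"
    by (simp add: crystal_sum_def enriched_crystal_simps)
  show "bij_betw ?h (carrier ?E) (carrier ?S)"
    unfolding S enriched_crystal_simps
  proof (rule bij_betw_byWitness[where f' = snd])
    show "?h ` enriched_partitions X r \<gamma> \<subseteq> (SIGMA w:?L. enriched_partitions X w \<gamma>)"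
      using iff by blast
    show "snd ` (SIGMA w:?L. enriched_partitions X w \<gamma>) \<subseteq> enriched_partitions X r \<gamma>"
      "\<forall>p\<in>SIGMA w:?L. enriched_partitions X w \<gamma>. ?h (snd p) = p"
      using iff by force+
  qed simp
  have op: "f_op (enriched_crystal X (sorting_order X \<gamma> \<sigma>) \<gamma>) i \<sigma> = f_op ?E i \<sigma>"
    "e_op (enriched_crystal X (sorting_order X \<gamma> \<sigma>) \<gamma>) i \<sigma> = e_op ?E i \<sigma>"
    if "\<sigma> \<in> enriched_partitions X r \<gamma>" for i \<sigma>
    using enriched_crystal_linear_extension_f[OF P, of "sorting_order X \<gamma> \<sigma>" \<sigma> i] iff that by blast+
  show "\<forall>\<sigma>\<in>carrier ?E. wt ?S (?h \<sigma>) = wt ?E \<sigma>"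
    by (simp add: crystal_sum_def enriched_crystal_simps)
  show "\<forall>i. \<forall>\<sigma>\<in>carrier ?E. eps ?S i (?h \<sigma>) = eps ?E i \<sigma> \<and> phi ?S i (?h \<sigma>) = phi ?E i \<sigma>"
    by (simp add: crystal_sum_def enriched_crystal_simps enriched_crystal_eps_phi op)
  note same = sorting_order_f[OF P]
  show "\<forall>i. \<forall>\<sigma>\<in>carrier ?E. \<forall>\<tau>\<in>carrier ?E. f_op ?E i \<sigma> = Some \<tau> \<longleftrightarrow> f_op ?S i (?h \<sigma>) = Some (?h \<tau>)"
  proof (intro allI ballI)
    fix i \<sigma> \<tau>
    assume \<sigma>: "\<sigma> \<in> carrier ?E" and "\<tau> \<in> carrier ?E"
    \<comment> \<open>An arrow of the sum stays inside one summand; \<open>sorting_order_f\<close>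
      shows that arrows of the poset do so as well.\<close>
    have "f_op ?S i (?h \<sigma>) = Some (?h \<tau>) \<longleftrightarrow>
        sorting_order X \<gamma> \<tau> = sorting_order X \<gamma> \<sigma> \<and> f_op ?E i \<sigma> = Some \<tau>"
      using \<sigma> op(1)[of \<sigma> i] by (auto simp: crystal_sum_def enriched_crystal_simps)
    then show "f_op ?E i \<sigma> = Some \<tau> \<longleftrightarrow> f_op ?S i (?h \<sigma>) = Some (?h \<tau>)"
      using same[of \<sigma> i \<tau>] \<sigma> by (auto simp: enriched_crystal_simps)
  qed
qed

section \<open>Crystals of linear orders\<close>

lemma linear_order_onD:
  assumes "linear_order_on X w"
  shows "(x, y) \<in> w \<Longrightarrow> x \<in> X \<and> y \<in> X" "x \<in> X \<Longrightarrow> (x, x) \<in> w"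
    "(x, y) \<in> w \<Longrightarrow> (y, z) \<in> w \<Longrightarrow> (x, z) \<in> w"
    "(x, y) \<in> w \<Longrightarrow> (y, x) \<in> w \<Longrightarrow> x = y"
    "x \<in> X \<Longrightarrow> y \<in> X \<Longrightarrow> (x, y) \<in> w \<or> (y, x) \<in> w"
proof -
  have w: "w \<subseteq> X \<times> X" "refl_on X w" "trans w" "antisym w" "total_on X w"
    using assms by (simp_all add: linear_order_on_def partial_order_on_def preorder_on_def)
  show "(x, y) \<in> w \<Longrightarrow> x \<in> X \<and> y \<in> X"
    using w(1) by blast
  show "x \<in> X \<Longrightarrow> (x, x) \<in> w"
    using w(2) by (rule refl_onD)
  show "(x, y) \<in> w \<Longrightarrow> (y, z) \<in> w \<Longrightarrow> (x, z) \<in> w"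
    using w(3) by (rule transD)
  show "(x, y) \<in> w \<Longrightarrow> (y, x) \<in> w \<Longrightarrow> x = y"
    using w(4) by (rule antisymD)
  show "x \<in> X \<Longrightarrow> y \<in> X \<Longrightarrow> (x, y) \<in> w \<or> (y, x) \<in> w"
    using w(2,5) by (cases "x = y") (auto simp: total_on_def refl_on_def)
qed

lemma order_list_unique:
  assumes "linear_order_on X w" "finite X"
  shows "\<exists>!xs. distinct xs \<and> set xs = X \<and> sorted_wrt (\<lambda>x y. (x, y) \<in> w) xs"
proof -
  \<comment> \<open>The rank of \<open>x\<close> in \<open>w\<close>. As a numerical key it turns
    sorting along \<open>w\<close> into sorting by numbers.\<close>
  define \<kappa> where "\<kappa> x = card {y \<in> X. (y, x) \<in> w}" for x
  have w: "\<And>x y. (x, y) \<in> w \<Longrightarrow> x \<in> X \<and> y \<in> X" "\<And>x. x \<in> X \<Longrightarrow> (x, x) \<in> w"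
    "\<And>x y z. (x, y) \<in> w \<Longrightarrow> (y, z) \<in> w \<Longrightarrow> (x, z) \<in> w"
    "\<And>x y. (x, y) \<in> w \<Longrightarrow> (y, x) \<in> w \<Longrightarrow> x = y"
    "\<And>x y. x \<in> X \<Longrightarrow> y \<in> X \<Longrightarrow> (x, y) \<in> w \<or> (y, x) \<in> w"
    by (fact linear_order_onD[OF assms(1)])+
  have less: "\<kappa> x < \<kappa> y" if "(x, y) \<in> w" "x \<noteq> y" for x y
    unfolding \<kappa>_def
  proof (rule psubset_card_mono)
    have "y \<in> {z \<in> X. (z, y) \<in> w} - {z \<in> X. (z, x) \<in> w}"
      using w that by blast
    moreover have "{z \<in> X. (z, x) \<in> w} \<subseteq> {z \<in> X. (z, y) \<in> w}"
      using w that by blast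
    ultimately show "{z \<in> X. (z, x) \<in> w} \<subset> {z \<in> X. (z, y) \<in> w}"
      by blast
  qed (simp add: assms)
  have less_iff: "\<kappa> x < \<kappa> y \<longleftrightarrow> (x, y) \<in> w \<and> x \<noteq> y" if "x \<in> X" "y \<in> X" for x y
    using less w(5)[OF that] by (metis less_asym)
  have inj: "inj_on \<kappa> X"
    using w(5) less by (intro inj_onI) (metis less_irrefl)
  note xs = sorted_key_list_of_set_inj_on[OF assms(2) inj]
  let ?xs = "sorted_key_list_of_set \<kappa> X"
  show ?thesis
  proof (rule ex1I[of _ ?xs])
    have "sorted_wrt (\<lambda>x y. \<kappa> x < \<kappa> y) ?xs"
      using xs(2) by (simp add: sorted_wrt_map)
    then have "sorted_wrt (\<lambda>x y. (x, y) \<in> w) ?xs"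
      by (rule sorted_wrt_mono_rel[rotated]) (use less_iff xs(1) in auto)
    then show "distinct ?xs \<and> set ?xs = X \<and> sorted_wrt (\<lambda>x y. (x, y) \<in> w) ?xs"
      using xs by (auto simp: strict_sorted_iff distinct_map)
  next
    fix ys
    assume ys: "distinct ys \<and> set ys = X \<and> sorted_wrt (\<lambda>x y. (x, y) \<in> w) ys"
    then have "sorted_wrt (\<lambda>x y. (x, y) \<in> w \<and> x \<noteq> y) ys"
      by (auto simp: sorted_wrt_iff_nth_less nth_eq_iff_index_eq)
    then have "sorted_wrt (\<lambda>x y. \<kappa> x < \<kappa> y) ys"
      by (rule sorted_wrt_mono_rel[rotated]) (use less in auto)
    then have "sorted_wrt (<) (map \<kappa> ys)"
      by (simp add: sorted_wrt_map)
    from sorted_key_list_of_set_unique_inj_on[OF this] show "ys = ?xs"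
      using ys by simp
  qed
qed

lemma order_list:
  assumes "linear_order_on X w" "finite X"
  shows "distinct (order_list X w)" "set (order_list X w) = X"
    "sorted_wrt (\<lambda>x y. (x, y) \<in> w) (order_list X w)"
  using theI'[OF order_list_unique[OF assms]] unfolding order_list_def by blast+

lemma order_list_eqI:
  assumes "linear_order_on X w" "distinct xs" "set xs = X" "sorted_wrt (\<lambda>x y. (x, y) \<in> w) xs"
  shows "order_list X w = xs"
  unfolding order_list_def
  by (rule the1_equality[OF order_list_unique]) (use assms in auto)

text \<open>The value sequences along a chain of length \<open>n\<close> with descent set
  \<open>D\<close>. List positions start at 0 and descents at 1, so the step from \<open>p\<close>
  to \<open>Suc p\<close> is governed by \<open>Suc p\<close>: a repeated letter is odd at a descent
  and even elsewhere.\<close>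

definition chain_words :: "nat \<Rightarrow> nat set \<Rightarrow> half list set" where
  "chain_words n D = {u. length u = n \<and> (\<forall>p. Suc p < n \<longrightarrow>
     u ! p < u ! Suc p \<or> u ! p = u ! Suc p \<and> (even_half (u ! p) \<longleftrightarrow> Suc p \<notin> D))}"

locale labeled_chain =
  fixes X :: "'a set" and w :: "'a rel" and \<gamma> :: "'a \<Rightarrow> nat"
  assumes labeled: "labeled_poset X w \<gamma>" and linear: "linear_order_on X w"
begin

abbreviation "xs \<equiv> order_list X w"

lemma finite_X: "finite X" and inj_\<gamma>: "inj_on \<gamma> X"
  using labeled by (auto simp: labeled_poset_def)

lemma xs: "distinct xs" "set xs = X" "sorted_wrt (\<lambda>x y. (x, y) \<in> w) xs"
  by (fact order_list[OF linear finite_X])+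

lemma length_xs [simp]: "length xs = card X"
  using distinct_card[OF xs(1)] xs(2) by simp

lemma nth_xs_in: "p < card X \<Longrightarrow> xs ! p \<in> X"
  using xs(2) by (metis length_xs nth_mem)

lemma nth_xs_less_iff: "p < card X \<Longrightarrow> q < card X \<Longrightarrow> (xs ! p, xs ! q) \<in> w \<and> xs ! p \<noteq> xs ! q \<longleftrightarrow> p < q"
proof -
  assume pq: "p < card X" "q < card X"
  have less: "(xs ! a, xs ! b) \<in> w" if "a < b" "b < card X" for a b
    using sorted_wrt_nth_less[OF xs(3), of a b] that by simp
  have "antisym w"
    using linear by (simp add: linear_order_on_def partial_order_on_def)
  moreover have "xs ! p = xs ! q \<longleftrightarrow> p = q"
    using pq xs(1) by (simp add: nth_eq_iff_index_eq)
  ultimately show ?thesis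
    using less[of p q] less[of q p] pq by (metis antisymD linorder_neqE_nat less_irrefl)
qed

text \<open>By transitivity it suffices to compare consecutive elements, and there the comparison of
  labels is exactly membership in the descent set.\<close>

lemma mem_enriched_iff_chain_words:
  assumes "\<sigma> \<in> X \<rightarrow>\<^sub>E UNIV"
  shows "\<sigma> \<in> enriched_partitions X w \<gamma> \<longleftrightarrow> map \<sigma> xs \<in> chain_words (card X) (descents X w \<gamma>)"
proof -
  have w: "(x, y) \<in> w \<Longrightarrow> x \<in> X \<and> y \<in> X" for x y
    using linear by (auto simp: linear_order_on_def partial_order_on_def preorder_on_def)
  have "\<sigma> \<in> enriched_partitions X w \<gamma> \<longleftrightarrow> (\<forall>x\<in>X. \<forall>y\<in>X. (x, y) \<in> w \<and> x \<noteq> y \<longrightarrow> enriched_less \<gamma> \<sigma> x y)"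
    using assms w unfolding mem_enriched_partitions_iff by blast
  also have "\<dots> \<longleftrightarrow> (\<forall>p<card X. \<forall>q<card X. p < q \<longrightarrow> enriched_less \<gamma> \<sigma> (xs ! p) (xs ! q))"
    (is "?l \<longleftrightarrow> ?r")
  proof
    show ?r if ?l
      using that nth_xs_less_iff nth_xs_in by blast
    show ?l if ?r
    proof (intro ballI impI)
      fix x y
      assume "x \<in> X" "y \<in> X" and xy: "(x, y) \<in> w \<and> x \<noteq> y"
      then obtain p q where "p < card X" "q < card X" "x = xs ! p" "y = xs ! q"
        using xs(2) by (metis in_set_conv_nth length_xs)
      with xy \<open>?r\<close> show "enriched_less \<gamma> \<sigma> x y"
        using nth_xs_less_iff by blast
    qed
  qed
  also have "\<dots> \<longleftrightarrow> sorted_wrt (enriched_less \<gamma> \<sigma>) xs"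
    by (auto simp: sorted_wrt_iff_nth_less)
  also have "\<dots> \<longleftrightarrow> (\<forall>p. Suc p < card X \<longrightarrow> enriched_less \<gamma> \<sigma> (xs ! p) (xs ! Suc p))"
    using sorted_wrt_iff_nth_Suc_transp[of "enriched_less \<gamma> \<sigma>" xs]
    by (auto intro!: transpI intro: enriched_less_trans)
  also have "\<dots> \<longleftrightarrow> map \<sigma> xs \<in> chain_words (card X) (descents X w \<gamma>)"
  proof -
    have "enriched_less \<gamma> \<sigma> (xs ! p) (xs ! Suc p) \<longleftrightarrow>
        \<sigma> (xs ! p) < \<sigma> (xs ! Suc p) \<or> \<sigma> (xs ! p) = \<sigma> (xs ! Suc p) \<and>
        (even_half (\<sigma> (xs ! p)) \<longleftrightarrow> Suc p \<notin> descents X w \<gamma>)" if "Suc p < card X" for p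
    proof -
      have "\<gamma> (xs ! p) \<noteq> \<gamma> (xs ! Suc p)"
        using that nth_xs_in[of p] nth_xs_in[of "Suc p"] inj_onD[OF inj_\<gamma>]
          nth_eq_iff_index_eq[OF xs(1), of p "Suc p"] by auto
      with that show ?thesis
        by (auto simp: enriched_less_def descents_def)
    qed
    then show ?thesis
      by (auto simp: chain_words_def)
  qed
  finally show ?thesis .
qed

lemma inj_on_map_xs: "inj_on (\<lambda>\<sigma>. map \<sigma> xs) (enriched_partitions X w \<gamma>)"
proof (rule inj_onI)
  fix \<sigma> \<tau>
  assume "\<sigma> \<in> enriched_partitions X w \<gamma>" "\<tau> \<in> enriched_partitions X w \<gamma>" and "map \<sigma> xs = map \<tau> xs"
  then show "\<sigma> = \<tau>"
    using xs(2) by (auto simp: mem_enriched_partitions_iff intro: PiE_ext)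
qed

lemma bij_betw_map_xs:
  "bij_betw (\<lambda>\<sigma>. map \<sigma> xs) (enriched_partitions X w \<gamma>) (chain_words (card X) (descents X w \<gamma>))"
  unfolding bij_betw_def
proof (intro conjI inj_on_map_xs equalityI subsetI)
  fix u
  assume "u \<in> (\<lambda>\<sigma>. map \<sigma> xs) ` enriched_partitions X w \<gamma>"
  then obtain \<sigma> where "\<sigma> \<in> enriched_partitions X w \<gamma>" "u = map \<sigma> xs"
    by blast
  moreover from this have "\<sigma> \<in> X \<rightarrow>\<^sub>E UNIV"
    by (simp add: mem_enriched_partitions_iff)
  ultimately show "u \<in> chain_words (card X) (descents X w \<gamma>)"
    using mem_enriched_iff_chain_words by blast
next
  fix u
  assume u: "u \<in> chain_words (card X) (descents X w \<gamma>)"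
  then have len: "length u = card X"
    by (simp add: chain_words_def)
  \<comment> \<open>Reads the value at the position of \<open>x\<close> in the chain; the value
    \<open>undefined\<close> outside \<open>X\<close> puts the function into the extensional
    function space.\<close>
  define \<sigma> where "\<sigma> x = (if x \<in> X then u ! (THE p. p < card X \<and> xs ! p = x) else undefined)" for x
  have "\<sigma> (xs ! p) = u ! p" if "p < card X" for p
  proof -
    have "(THE q. q < card X \<and> xs ! q = xs ! p) = p"
      using that nth_eq_iff_index_eq[OF xs(1)] by (intro the_equality) auto
    then show ?thesis
      using nth_xs_in[OF that] by (simp add: \<sigma>_def)
  qed
  then have map: "map \<sigma> xs = u"
    by (intro nth_equalityI) (auto simp: len)
  have "\<sigma> \<in> X \<rightarrow>\<^sub>E UNIV"
    by (auto simp: \<sigma>_def PiE_iff extensional_def)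
  with u map have "\<sigma> \<in> enriched_partitions X w \<gamma>"
    using mem_enriched_iff_chain_words by blast
  with map show "u \<in> (\<lambda>\<sigma>. map \<sigma> xs) ` enriched_partitions X w \<gamma>"
    by blast
qed

text \<open>The reading list is ordered by labels and \<open>xs\<close> by \<open>w\<close>, but
  they enumerate the same set, and a weight depends only on the multiset of letters.\<close>

lemma wt_enriched_crystal: "wt (enriched_crystal X w \<gamma>) \<sigma> = word_weight (map \<sigma> xs)"
proof -
  note ys = reading_list[OF finite_X inj_\<gamma>]
  have "mset (reading_list X \<gamma>) = mset xs"
    using ys(1,2) xs(1,2) by (metis set_eq_iff_mset_eq_distinct)
  then have "mset (map \<sigma> (reading_list X \<gamma>)) = mset (map \<sigma> xs)"
    by simp
  then have "mset (map weight_eps (map \<sigma> (reading_list X \<gamma>))) = mset (map weight_eps (map \<sigma> xs))"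
    by (metis mset_map)
  then show ?thesis
    unfolding enriched_crystal_simps word_weight_def partition_word_reading_list
    by (metis sum_mset_sum_list)
qed

text \<open>Every other \<open>y\<close> is comparable with \<open>x\<close>. In the band of values
  \<open>i\<close> and \<open>half_succ i\<close>, a \<open>y\<close> after \<open>x\<close> must
  have value \<open>half_succ i\<close> and still follow \<open>x\<close> once \<open>x\<close> is
  raised; a \<open>y\<close> before \<open>x\<close> must have value \<open>i\<close>. In both cases
  the tie-breaking yields the comparison of labels that \<open>active\<close> asks for.\<close>

lemma chain_update_active:
  assumes \<sigma>: "\<sigma> \<in> enriched_partitions X w \<gamma>" and \<tau>: "\<sigma>(x := half_succ i) \<in> enriched_partitions X w \<gamma>"
    and x: "x \<in> X" "\<sigma> x = i"
  shows "active X \<gamma> \<sigma> i x"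
  unfolding active_def
proof (intro conjI ballI impI)
  show "x \<in> X" "\<sigma> x \<in> {i, half_succ i}"
    using x by simp_all
  fix y
  assume y: "y \<in> X" "\<sigma> y \<in> {i, half_succ i}"
  show "if even_half i then \<gamma> y \<le> \<gamma> x else \<gamma> x \<le> \<gamma> y"
  proof (cases "y = x")
    case False
    then have "(x, y) \<in> w \<or> (y, x) \<in> w"
      using linear x(1) y(1) by (auto simp: linear_order_on_def total_on_def)
    then show ?thesis
    proof
      assume xy: "(x, y) \<in> w"
      then have "enriched_less \<gamma> \<sigma> x y" "enriched_less \<gamma> (\<sigma>(x := half_succ i)) x y"
        using \<sigma> \<tau> False by (auto simp: mem_enriched_partitions_iff)
      then have "\<sigma> y = half_succ i"
        using y(2) x(2) False less_half_succ[of i]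
        by (metis enriched_less_def fun_upd_apply half_succ_neq(1) less_asym insertE singletonD)
      then show ?thesis
        using \<open>enriched_less \<gamma> (\<sigma>(x := half_succ i)) x y\<close> False
        by (cases "even_half i") (simp_all add: enriched_less_def)
    next
      assume yx: "(y, x) \<in> w"
      then have "enriched_less \<gamma> \<sigma> y x"
        using \<sigma> False by (auto simp: mem_enriched_partitions_iff)
      moreover from this have "\<sigma> y = i"
        using y(2) x(2) less_half_succ[of i]
        by (metis enriched_less_def half_succ_neq(1) less_asym insertE singletonD)
      ultimately show ?thesis
        using x(2) by (cases "even_half i") (simp_all add: enriched_less_def)
    qed
  qed simp
qed

lemma chain_f_iff:
  assumes \<sigma>: "\<sigma> \<in> enriched_partitions X w \<gamma>" and \<tau>: "\<tau> \<in> enriched_partitions X w \<gamma>"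
  shows "f_op (enriched_crystal X w \<gamma>) i \<sigma> = Some \<tau> \<longleftrightarrow>
    (\<exists>p<card X. map \<sigma> xs ! p = i \<and> map \<tau> xs = (map \<sigma> xs)[p := half_succ i])"
proof -
  have "f_op (enriched_crystal X w \<gamma>) i \<sigma> = Some \<tau> \<longleftrightarrow> (\<exists>x\<in>X. \<sigma> x = i \<and> \<tau> = \<sigma>(x := half_succ i))"
    unfolding enriched_crystal_f[OF labeled \<sigma>]
    using chain_update_active[OF \<sigma>] \<tau> by (auto simp: active_def)
  also have "\<dots> \<longleftrightarrow> (\<exists>p<card X. \<sigma> (xs ! p) = i \<and> \<tau> = \<sigma>(xs ! p := half_succ i))"
    using xs(2) by (metis in_set_conv_nth length_xs)
  also have "\<dots> \<longleftrightarrow> (\<exists>p<card X. map \<sigma> xs ! p = i \<and> map \<tau> xs = (map \<sigma> xs)[p := half_succ i])"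
  proof (intro ex_cong1 conj_cong refl)
    fix p
    assume p: "p < card X"
    have upd: "(map \<sigma> xs)[p := half_succ i] = map (\<sigma>(xs ! p := half_succ i)) xs"
      using p xs(1) by (intro nth_equalityI) (auto simp: nth_list_update nth_eq_iff_index_eq)
    have "\<sigma>(xs ! p := half_succ i) \<in> X \<rightarrow>\<^sub>E UNIV" "\<tau> \<in> X \<rightarrow>\<^sub>E UNIV"
      using \<sigma> \<tau> nth_xs_in[OF p] by (auto simp: mem_enriched_partitions_iff PiE_iff extensional_def)
    then show "\<tau> = \<sigma>(xs ! p := half_succ i) \<longleftrightarrow> map \<tau> xs = (map \<sigma> xs)[p := half_succ i]"
      unfolding upd map_eq_conv xs(2) by (metis PiE_ext)
    show "\<sigma> (xs ! p) = i \<longleftrightarrow> map \<sigma> xs ! p = i"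
      using p by simp
  qed
  finally show ?thesis .
qed

end

section \<open>Recovering the length and the descents from the chain words\<close>

lemma strict_chain_word: "map half_of_nat [0..<n] \<in> chain_words n D"
  by (auto simp: chain_words_def)

text \<open>The integers 1, 2, ..., p + 1, p + 1, p + 2, ...: strictly increasing apart from one
  repeated even letter at positions \<open>p\<close> and \<open>Suc p\<close>. It tests whether
  \<open>Suc p\<close> is a descent.\<close>

definition plateau_word :: "nat \<Rightarrow> nat \<Rightarrow> half list" where
  "plateau_word n p = map (\<lambda>q. half_of_nat (if q \<le> p then 2 * q + 1 else 2 * q - 1)) [0..<n]"

lemma plateau_word_in_chain_words_iff:
  assumes "Suc p < n"
  shows "plateau_word n p \<in> chain_words n D \<longleftrightarrow> Suc p \<notin> D"
proof -
  have nth: "plateau_word n p ! q = half_of_nat (if q \<le> p then 2 * q + 1 else 2 * q - 1)" if "q < n" for q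
    using that by (simp add: plateau_word_def)
  have "plateau_word n p ! q < plateau_word n p ! Suc q" if "Suc q < n" "q \<noteq> p" for q
    using that by (auto simp: nth)
  moreover have "plateau_word n p ! p = plateau_word n p ! Suc p" "even_half (plateau_word n p ! p)"
    using assms by (auto simp: nth)
  moreover have "plateau_word n p \<in> chain_words n D \<longleftrightarrow> (\<forall>q. Suc q < n \<longrightarrow>
     plateau_word n p ! q < plateau_word n p ! Suc q \<or> plateau_word n p ! q = plateau_word n p ! Suc q \<and>
     (even_half (plateau_word n p ! q) \<longleftrightarrow> Suc q \<notin> D))"
    by (simp add: chain_words_def) (simp add: plateau_word_def)
  ultimately show ?thesis
    using assms by (metis less_irrefl)
qed

text \<open>A strictly increasing word belongs to every set of chain words of its length and so
  reveals the length; the plateau words then reveal the descents. The bounds on \<open>D\<close> and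
  \<open>E\<close> are needed because elements outside them leave no trace in
  \<open>chain_words\<close>.\<close>

lemma chain_words_inject:
  assumes "chain_words m D = chain_words n E" "D \<subseteq> {1..<m}" "E \<subseteq> {1..<n}"
  shows "m = n" "D = E"
proof -
  have "map half_of_nat [0..<m] \<in> chain_words n E"
    using strict_chain_word assms(1) by blast
  then show "m = n"
    by (simp add: chain_words_def)
  with assms have "Suc p \<in> D \<longleftrightarrow> Suc p \<in> E" if "Suc p < n" for p
    using plateau_word_in_chain_words_iff[OF that] by blast
  moreover have "0 \<notin> D" "0 \<notin> E"
    using assms(2,3) by auto
  moreover have "p < n" if "p \<in> D \<or> p \<in> E" for p
    using that assms(2,3) \<open>m = n\<close> by auto
  ultimately show "D = E"
    by (metis not0_implies_Suc set_eqI)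
qed

lemma chain_words_sorted: "u \<in> chain_words n D \<Longrightarrow> sorted u"
  by (auto simp: chain_words_def sorted_iff_nth_Suc)

lemma word_weight_inject:
  assumes "word_weight u = word_weight v" "sorted u" "sorted v"
  shows "u = v"
proof -
  have "count_list u b = count_list v b" for b
    using lookup_word_weight[of u b] lookup_word_weight[of v b] assms(1) by simp
  then have "mset u = mset v"
    by (simp add: multiset_eq_iff count_mset count_list_eq_length_filter)
  with assms(2,3) show ?thesis
    by (metis properties_for_sort)
qed

text \<open>The entries of the pointwise least chain word, chosen greedily.\<close>

fun least_entry :: "nat set \<Rightarrow> nat \<Rightarrow> half" where
  "least_entry D 0 = half_of_nat 0"
| "least_entry D (Suc p) =
     (if even_half (least_entry D p) \<longleftrightarrow> Suc p \<notin> D then least_entry D p else half_succ (least_entry D p))"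

lemma least_word_in_chain_words: "map (least_entry D) [0..<n] \<in> chain_words n D"
  by (auto simp: chain_words_def)

text \<open>Lower the first entry that differs from the greedy word; it is larger there, so it has a
  predecessor \<open>c\<close>. On its left the word agrees with the greedy one, which permits every
  value from \<open>least_entry D p\<close> upwards; on its right the next entry is at least the old
  value, hence above \<open>c\<close>.\<close>

lemma chain_word_lower:
  assumes u: "u \<in> chain_words n D" and "u \<noteq> map (least_entry D) [0..<n]"
  obtains p c where "p < n" "u ! p = half_succ c" "u[p := c] \<in> chain_words n D"
proof -
  have len: "length u = n"
    and step: "\<And>p. Suc p < n \<Longrightarrow> u ! p < u ! Suc p \<or> u ! p = u ! Suc p \<and> (even_half (u ! p) \<longleftrightarrow> Suc p \<notin> D)"
    using u by (auto simp: chain_words_def)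
  have "\<exists>p<n. u ! p \<noteq> least_entry D p"
    using assms(2) len by (metis (no_types, lifting) length_map length_upt minus_nat.diff_0 nth_equalityI nth_map_upt add_0)
  then obtain p where p: "p < n" "u ! p \<noteq> least_entry D p"
    and below: "\<And>q. q < p \<Longrightarrow> u ! q = least_entry D q"
    using exists_least_iff[of "\<lambda>p. p < n \<and> u ! p \<noteq> least_entry D p"] by (metis order_less_trans)
  have "least_entry D p < u ! p"
  proof (cases p)
    case 0
    then show ?thesis
      using p by (cases "u ! p") auto
  next
    case (Suc q)
    then have "u ! q = least_entry D q"
      by (simp add: below)
    then show ?thesis
      using step[of q] p unfolding Suc
      by (auto simp: half_succ_le_iff less_le split: if_splits)
  qed
  then obtain c where c: "u ! p = half_succ c" "least_entry D p \<le> c"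
    by (cases "u ! p"; cases "least_entry D p") (metis half_succ_half_of_nat half_of_nat_le_iff half_of_nat_less_iff lessE less_Suc_eq_le)
  have "u[p := c] ! q < u[p := c] ! Suc q \<or>
      u[p := c] ! q = u[p := c] ! Suc q \<and> (even_half (u[p := c] ! q) \<longleftrightarrow> Suc q \<notin> D)" if q: "Suc q < n" for q
  proof -
    consider "q = p" | "Suc q = p" | "q \<noteq> p" "Suc q \<noteq> p"
      by blast
    then show ?thesis
    proof cases
      case 1
      have "c < half_succ c"
        by simp
      also have "\<dots> \<le> u ! Suc q"
        using step[OF q] 1 c by auto
      finally show ?thesis
        using 1 q len by simp
    next
      case 2
      have eq: "u[p := c] ! q = least_entry D q" "u[p := c] ! Suc q = c"
        using 2 below[of q] p(1) len by auto
      \<comment> \<open>Either the greedy rule repeats its letter, which makes equality admissible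
        here too, or it moves up, which makes this step strict.\<close>
      have "least_entry D (Suc q) \<le> c"
        using c(2) 2 by simp
      then show ?thesis
        unfolding eq by (auto simp: half_succ_le_iff split: if_splits)
    next
      case 3
      then show ?thesis
        using step[OF q] by simp
    qed
  qed
  then have "u[p := c] \<in> chain_words n D"
    using len by (simp add: chain_words_def)
  with p(1) c(1) show thesis
    by (rule that)
qed

section \<open>Connectedness of the crystal of a chain\<close>

abbreviation crystal_connection :: "'b crystal_data \<Rightarrow> 'b rel" where
  "crystal_connection B \<equiv> (crystal_edges B \<union> (crystal_edges B)\<inverse>)\<^sup>*"

lemma descents_subset: "descents X w \<gamma> \<subseteq> {1..<card X}"
  by (auto simp: descents_def)

context labeled_chain
begin

text \<open>Induction on the sum of the indices of the letters, which drops whenever an entry is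
  lowered. The lowered word comes from some \<tau>, and raising that entry again is an arrow from
  \<tau> to \<sigma>, so the path is directed away from the least element.\<close>

lemma connected_to_least:
  assumes \<sigma>\<^sub>0: "\<sigma>\<^sub>0 \<in> enriched_partitions X w \<gamma>"
      "map \<sigma>\<^sub>0 xs = map (least_entry (descents X w \<gamma>)) [0..<card X]"
    and "\<sigma> \<in> enriched_partitions X w \<gamma>"
  shows "(\<sigma>\<^sub>0, \<sigma>) \<in> (crystal_edges (enriched_crystal X w \<gamma>))\<^sup>*"
  using assms(3)
proof (induction "sum_list (map (inv half_of_nat) (map \<sigma> xs))" arbitrary: \<sigma> rule: less_induct)
  case less
  let ?Q = "chain_words (card X) (descents X w \<gamma>)"
  show ?case
  proof (cases "map \<sigma> xs = map (least_entry (descents X w \<gamma>)) [0..<card X]")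
    case True
    then have "\<sigma>\<^sub>0 = \<sigma>"
      using inj_onD[OF inj_on_map_xs] \<sigma>\<^sub>0 less.prems by metis
    then show ?thesis
      by simp
  next
    case False
    have "map \<sigma> xs \<in> ?Q"
      using bij_betw_apply[OF bij_betw_map_xs less.prems] .
    then obtain p c where p: "p < card X" "map \<sigma> xs ! p = half_succ c" "(map \<sigma> xs)[p := c] \<in> ?Q"
      using False by (rule chain_word_lower)
    then obtain \<tau> where \<tau>: "\<tau> \<in> enriched_partitions X w \<gamma>" "map \<tau> xs = (map \<sigma> xs)[p := c]"
      using bij_betw_imp_surj_on[OF bij_betw_map_xs] by (metis (no_types, lifting) imageE)
    have "map \<tau> xs ! p = c"
      using p(1) unfolding \<tau>(2) by simp
    moreover have "map \<sigma> xs = (map \<tau> xs)[p := half_succ c]"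
      unfolding \<tau>(2) using p(2) by (metis list_update_id list_update_overwrite)
    ultimately have "f_op (enriched_crystal X w \<gamma>) c \<tau> = Some \<sigma>"
      using chain_f_iff[OF \<tau>(1) less.prems] p(1) by blast
    then have edge: "(\<tau>, \<sigma>) \<in> crystal_edges (enriched_crystal X w \<gamma>)"
      using \<tau>(1) less.prems by (auto simp: crystal_edges_def enriched_crystal_simps)
    have inv: "inv half_of_nat (half_of_nat m) = m" for m
      by (rule inv_f_f) (simp add: inj_def)
    have rank: "inv half_of_nat c < inv half_of_nat (half_succ c)"
      by (cases c) (simp add: inv)
    have "sum_list (map (inv half_of_nat) ((map \<tau> xs)[p := half_succ c])) =
        sum_list (map (inv half_of_nat) (map \<tau> xs)) + inv half_of_nat (half_succ c) - inv half_of_nat c"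
      unfolding map_update using p(1) \<open>map \<tau> xs ! p = c\<close>
      by (subst sum_list_update) (simp_all del: map_map)
    then have "sum_list (map (inv half_of_nat) (map \<tau> xs)) < sum_list (map (inv half_of_nat) (map \<sigma> xs))"
      using rank \<open>map \<sigma> xs = (map \<tau> xs)[p := half_succ c]\<close> by simp
    then have "(\<sigma>\<^sub>0, \<tau>) \<in> (crystal_edges (enriched_crystal X w \<gamma>))\<^sup>*"
      using less.hyps \<tau>(1) by blast
    with edge show ?thesis
      by simp
  qed
qed

lemma connected:
  assumes "\<sigma> \<in> enriched_partitions X w \<gamma>" "\<tau> \<in> enriched_partitions X w \<gamma>"
  shows "(\<sigma>, \<tau>) \<in> crystal_connection (enriched_crystal X w \<gamma>)"
proof -
  let ?R = "crystal_edges (enriched_crystal X w \<gamma>)"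
  obtain \<sigma>\<^sub>0 where \<sigma>\<^sub>0: "\<sigma>\<^sub>0 \<in> enriched_partitions X w \<gamma>"
    "map \<sigma>\<^sub>0 xs = map (least_entry (descents X w \<gamma>)) [0..<card X]"
    using bij_betw_imp_surj_on[OF bij_betw_map_xs] least_word_in_chain_words
    by (metis (no_types, lifting) imageE)
  have "(\<sigma>, \<sigma>\<^sub>0) \<in> (?R\<inverse>)\<^sup>*"
    using connected_to_least[OF \<sigma>\<^sub>0 assms(1)] by (simp add: rtrancl_converse)
  moreover have "(\<sigma>\<^sub>0, \<tau>) \<in> ?R\<^sup>*"
    by (rule connected_to_least[OF \<sigma>\<^sub>0 assms(2)])
  ultimately show ?thesis
    by (meson in_rtrancl_UnI rtrancl_trans)
qed

lemma enriched_partitions_nonempty: "enriched_partitions X w \<gamma> \<noteq> {}"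
  using bij_betw_imp_surj_on[OF bij_betw_map_xs] strict_chain_word by blast

lemma chain_f_map_iff:
  assumes "labeled_chain X' w' \<gamma>'" "card X = card X'"
    and \<sigma>: "\<sigma> \<in> enriched_partitions X w \<gamma>" "\<tau> \<in> enriched_partitions X w \<gamma>"
    and \<sigma>': "\<sigma>' \<in> enriched_partitions X' w' \<gamma>'" "\<tau>' \<in> enriched_partitions X' w' \<gamma>'"
    and eq: "map \<sigma>' (order_list X' w') = map \<sigma> xs" "map \<tau>' (order_list X' w') = map \<tau> xs"
  shows "f_op (enriched_crystal X w \<gamma>) i \<sigma> = Some \<tau> \<longleftrightarrow> f_op (enriched_crystal X' w' \<gamma>') i \<sigma>' = Some \<tau>'"
  unfolding chain_f_iff[OF \<sigma>] labeled_chain.chain_f_iff[OF assms(1) \<sigma>'] eq assms(2) ..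

end

section \<open>Comparing the crystals of two chains\<close>

lemma gl_crystal_e_ne_None_iff:
  assumes "gl_crystal B" "b \<in> carrier B"
  shows "e_op B i b \<noteq> None \<longleftrightarrow> (\<exists>a\<in>carrier B. f_op B i a = Some b)"
  using gl_crystalD(1,6)[OF assms(1)] assms(2) by (metis not_None_eq)

lemma gl_crystal_f_ne_None_iff:
  assumes "gl_crystal B" "b \<in> carrier B"
  shows "f_op B i b \<noteq> None \<longleftrightarrow> (\<exists>a\<in>carrier B. f_op B i b = Some a)"
  using gl_crystalD(2)[OF assms] by (metis not_None_eq)

lemma enriched_chain_iso_iff:
  assumes C: "labeled_chain X w \<gamma>" and C': "labeled_chain X' w' \<gamma>'"
  shows "enriched_crystal X w \<gamma> \<simeq> enriched_crystal X' w' \<gamma>' \<longleftrightarrow>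
    card X = card X' \<and> descents X w \<gamma> = descents X' w' \<gamma>'"
proof -
  interpret C: labeled_chain X w \<gamma> by (rule C)
  interpret C': labeled_chain X' w' \<gamma>' by (rule C')
  let ?A = "enriched_partitions X w \<gamma>" and ?A' = "enriched_partitions X' w' \<gamma>'"
  let ?B = "enriched_crystal X w \<gamma>" and ?B' = "enriched_crystal X' w' \<gamma>'"
  let ?F = "\<lambda>\<sigma>. map \<sigma> C.xs" and ?F' = "\<lambda>\<sigma>. map \<sigma> C'.xs"
  let ?Q = "chain_words (card X) (descents X w \<gamma>)" and ?Q' = "chain_words (card X') (descents X' w' \<gamma>')"
  note F = C.bij_betw_map_xs and F' = C'.bij_betw_map_xs
  note gl = gl_crystal_enriched_crystal[OF C.labeled] gl_crystal_enriched_crystal[OF C'.labeled]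
  show ?thesis
  proof
    assume "?B \<simeq> ?B'"
    then obtain h where h: "bij_betw h ?A ?A'" "\<forall>\<sigma>\<in>?A. wt ?B' (h \<sigma>) = wt ?B \<sigma>"
      by (auto simp: crystal_iso_def enriched_crystal_simps(1))
    \<comment> \<open>Equal weights of sorted words force equality, so an isomorphism can only match
      elements with the same value sequence, and the two sets of chain words coincide.\<close>
    have "?F' (h \<sigma>) = ?F \<sigma>" if "\<sigma> \<in> ?A" for \<sigma>
    proof (rule word_weight_inject)
      show "word_weight (?F' (h \<sigma>)) = word_weight (?F \<sigma>)"
        using h(2) that by (simp add: C.wt_enriched_crystal C'.wt_enriched_crystal)
      show "sorted (?F \<sigma>)"
        by (rule chain_words_sorted) (rule bij_betw_apply[OF F that])
      show "sorted (?F' (h \<sigma>))"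
        by (rule chain_words_sorted) (rule bij_betw_apply[OF F' bij_betw_apply[OF h(1) that]])
    qed
    then have "?F ` ?A = ?F' ` h ` ?A"
      by (simp add: image_image)
    then have "?Q = ?Q'"
      using F F' h(1) by (simp add: bij_betw_imp_surj_on)
    then show "card X = card X' \<and> descents X w \<gamma> = descents X' w' \<gamma>'"
      using chain_words_inject[OF _ descents_subset descents_subset] by blast
  next
    assume eq: "card X = card X' \<and> descents X w \<gamma> = descents X' w' \<gamma>'"
    then have F'': "bij_betw ?F' ?A' ?Q"
      using F' by simp
    \<comment> \<open>Matches elements by their values along the two chains. Their reading words
      need not agree, since these depend on the labels.\<close>
    define h where "h = inv_into ?A' ?F' \<circ> ?F"
    have h: "bij_betw h ?A ?A'"
      unfolding h_def by (rule bij_betw_trans[OF F bij_betw_inv_into[OF F'']])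
    have Fh: "?F' (h \<sigma>) = ?F \<sigma>" if "\<sigma> \<in> ?A" for \<sigma>
      unfolding h_def comp_def
      by (rule bij_betw_inv_into_right[OF F'' bij_betw_apply[OF F that]])
    note hA = bij_betw_apply[OF h]
    have f: "f_op ?B i \<sigma> = Some \<tau> \<longleftrightarrow> f_op ?B' i (h \<sigma>) = Some (h \<tau>)" if "\<sigma> \<in> ?A" "\<tau> \<in> ?A" for i \<sigma> \<tau>
      using that eq by (intro C.chain_f_map_iff C' hA Fh) auto
    have ex: "(\<exists>\<tau>\<in>?A'. P \<tau>) \<longleftrightarrow> (\<exists>\<tau>\<in>?A. P (h \<tau>))" for P
      unfolding bij_betw_imp_surj_on[OF h, symmetric] by simp
    \<comment> \<open>Definedness of \<open>f\<close> and \<open>e\<close> means that an outgoing or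
      incoming arrow exists within the carrier. A bijection that preserves arrows therefore
      preserves \<open>phi\<close> and \<open>eps\<close>.\<close>
    have "f_op ?B i \<sigma> \<noteq> None \<longleftrightarrow> f_op ?B' i (h \<sigma>) \<noteq> None" if "\<sigma> \<in> ?A" for i \<sigma>
      using gl_crystal_f_ne_None_iff[OF gl(1), of \<sigma> i] gl_crystal_f_ne_None_iff[OF gl(2), of "h \<sigma>" i]
        f[OF that] hA[OF that] that by (simp add: enriched_crystal_simps(1) ex)
    moreover have "e_op ?B i \<sigma> \<noteq> None \<longleftrightarrow> e_op ?B' i (h \<sigma>) \<noteq> None" if "\<sigma> \<in> ?A" for i \<sigma>
      using gl_crystal_e_ne_None_iff[OF gl(1), of \<sigma> i] gl_crystal_e_ne_None_iff[OF gl(2), of "h \<sigma>" i]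
        f[OF _ that] hA[OF that] that by (simp add: enriched_crystal_simps(1) ex)
    ultimately show "?B \<simeq> ?B'"
      unfolding crystal_iso_def
      using gl h f Fh
      by (intro conjI exI[of _ h])
        (simp_all add: enriched_crystal_simps(1) enriched_crystal_eps_phi
          C.wt_enriched_crystal C'.wt_enriched_crystal)
  qed
qed

text \<open>A component of the poset crystal and the crystal of the corresponding chain agree on
  their common carrier but need not be equal records; agreement on the carrier suffices for
  isomorphism.\<close>

lemma crystal_iso_cong:
  assumes "carrier A = carrier A'"
    and "\<And>b. b \<in> carrier A \<Longrightarrow> wt A b = wt A' b"
    and "\<And>i b. b \<in> carrier A \<Longrightarrow> eps A i b = eps A' i b"
    and "\<And>i b. b \<in> carrier A \<Longrightarrow> phi A i b = phi A' i b"
    and "\<And>i b. b \<in> carrier A \<Longrightarrow> e_op A i b = e_op A' i b"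
    and "\<And>i b. b \<in> carrier A \<Longrightarrow> f_op A i b = f_op A' i b"
    and "A' \<simeq> B"
  shows "A \<simeq> B"
proof -
  have A': "gl_crystal A'"
    using assms(7) by (simp add: crystal_iso_def)
  have "gl_crystal A"
  proof (rule gl_crystalI)
    fix i b b'
    assume "b \<in> carrier A"
    then have b: "b \<in> carrier A'"
      using assms(1) by simp
    show "e_op A i b = Some b' \<Longrightarrow> b' \<in> carrier A" "f_op A i b = Some b' \<Longrightarrow> b' \<in> carrier A"
      "phi A i b + eps A i b = (if weight_form (wt A b) (simple_root i) \<noteq> 0 then 1 else 0)"
      "b' \<in> carrier A \<Longrightarrow> f_op A i b = Some b' \<longleftrightarrow> e_op A i b' = Some b"
      using gl_crystalD(1-3,6)[OF A' b] assms(1-6) b by metis+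
    show "e_op A i b = Some b' \<Longrightarrow> int (eps A i b') = int (eps A i b) - 1 \<and>
       int (phi A i b') = int (phi A i b) + 1 \<and> wt A b' = wt A b + simple_root i"
      using gl_crystalD(1,4)[OF A' b, of i b'] assms(1-6) b by metis
    show "f_op A i b = Some b' \<Longrightarrow> int (eps A i b') = int (eps A i b) + 1 \<and>
       int (phi A i b') = int (phi A i b) - 1 \<and> wt A b' = wt A b - simple_root i"
      using gl_crystalD(2,5)[OF A' b, of i b'] assms(1-6) b by metis
  qed
  with assms show ?thesis
    unfolding crystal_iso_def by auto
qed

text \<open>The sorting order is constant along arrows, so a component stays inside one piece.
  Conversely each piece is connected as the crystal of a chain, and its edges are edges of the poset
  crystal.\<close>

lemma crystal_components_enriched_crystal:
  assumes P: "labeled_poset X r \<gamma>"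
  shows "crystal_components (enriched_crystal X r \<gamma>) =
    (\<lambda>w. enriched_crystal X r \<gamma>\<lparr>carrier := enriched_partitions X w \<gamma>\<rparr>) ` linear_extensions X r"
proof -
  let ?E = "enriched_crystal X r \<gamma>" and ?L = "linear_extensions X r"
  note iff = enriched_partitions_linear_extension_iff[OF P]
  have chain: "labeled_chain X w \<gamma>" if "w \<in> ?L" for w
    using linear_extensions_labeled_poset[OF P that] by unfold_locales
  have edges: "crystal_edges (enriched_crystal X w \<gamma>) \<subseteq> crystal_edges ?E" if "w \<in> ?L" for w
    using enriched_crystal_linear_extension_f(1)[OF P that] iff that
    by (fastforce simp: crystal_edges_def enriched_crystal_simps)
  have component: "crystal_connection ?E `` {\<sigma>} = enriched_partitions X (sorting_order X \<gamma> \<sigma>) \<gamma>"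
    if \<sigma>: "\<sigma> \<in> enriched_partitions X r \<gamma>" for \<sigma>
  proof (intro equalityI subsetI)
    fix \<tau>
    assume "\<tau> \<in> crystal_connection ?E `` {\<sigma>}"
    then have "(\<sigma>, \<tau>) \<in> crystal_connection ?E"
      by simp
    then have "\<tau> \<in> enriched_partitions X r \<gamma> \<and> sorting_order X \<gamma> \<tau> = sorting_order X \<gamma> \<sigma>"
    proof induction
      case base
      with \<sigma> show ?case by simp
    next
      case (step \<tau> \<upsilon>)
      then show ?case
        using sorting_order_f[OF P] by (auto simp: crystal_edges_def enriched_crystal_simps(1))
    qed
    then show "\<tau> \<in> enriched_partitions X (sorting_order X \<gamma> \<sigma>) \<gamma>"
      using iff by metis
  next
    let ?w = "sorting_order X \<gamma> \<sigma>"
    fix \<tau>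
    assume \<tau>: "\<tau> \<in> enriched_partitions X ?w \<gamma>"
    have w: "?w \<in> ?L" "\<sigma> \<in> enriched_partitions X ?w \<gamma>"
      using iff \<sigma> by blast+
    have "(\<sigma>, \<tau>) \<in> crystal_connection (enriched_crystal X ?w \<gamma>)"
      by (rule labeled_chain.connected[OF chain[OF w(1)] w(2) \<tau>])
    also have "\<dots> \<subseteq> crystal_connection ?E"
      using edges[OF w(1)] by (intro rtrancl_mono) blast
    finally show "\<tau> \<in> crystal_connection ?E `` {\<sigma>}"
      by simp
  qed
  have "enriched_partitions X r \<gamma> // crystal_connection ?E =
      (\<lambda>\<sigma>. enriched_partitions X (sorting_order X \<gamma> \<sigma>) \<gamma>) ` enriched_partitions X r \<gamma>"
    unfolding quotient_def using component by auto
  also have "\<dots> = (\<lambda>w. enriched_partitions X w \<gamma>) ` sorting_order X \<gamma> ` enriched_partitions X r \<gamma>"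
    by (simp add: image_image)
  also have "sorting_order X \<gamma> ` enriched_partitions X r \<gamma> = ?L"
  proof (intro equalityI subsetI)
    fix w
    assume "w \<in> sorting_order X \<gamma> ` enriched_partitions X r \<gamma>"
    then show "w \<in> ?L"
      using iff by blast
  next
    fix w
    assume w: "w \<in> ?L"
    \<comment> \<open>Pieces are nonempty, so every linear extension contributes a
      component.\<close>
    then obtain \<sigma> where "\<sigma> \<in> enriched_partitions X w \<gamma>"
      using labeled_chain.enriched_partitions_nonempty[OF chain] by blast
    with w show "w \<in> sorting_order X \<gamma> ` enriched_partitions X r \<gamma>"
      using iff by blast
  qed
  finally show ?thesis
    unfolding crystal_components_def by (simp add: enriched_crystal_simps(1) image_image)
qed

text \<open>Components can be counted by linear extensions because the pieces are nonempty and
  disjoint, so that distinct extensions yield distinct carriers.\<close>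

lemma multiplicity_enriched_crystal:
  assumes P: "labeled_poset X r \<gamma>"
  shows "multiplicity B (enriched_crystal X r \<gamma>) =
    enat (card {w \<in> linear_extensions X r. enriched_crystal X w \<gamma> \<simeq> B})"
proof -
  let ?E = "enriched_crystal X r \<gamma>" and ?L = "linear_extensions X r"
  let ?c = "\<lambda>w. ?E\<lparr>carrier := enriched_partitions X w \<gamma>\<rparr>"
  note iff = enriched_partitions_linear_extension_iff[OF P]
  have chain: "labeled_chain X w \<gamma>" if "w \<in> ?L" for w
    using linear_extensions_labeled_poset[OF P that] by unfold_locales
  have inj: "inj_on ?c ?L"
  proof (rule inj_onI)
    fix v w
    assume vw: "v \<in> ?L" "w \<in> ?L" "?c v = ?c w"
    from vw(3) have "carrier (?c v) = carrier (?c w)"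
      by (rule arg_cong)
    then have "enriched_partitions X v \<gamma> = enriched_partitions X w \<gamma>"
      by simp
    moreover obtain \<sigma> where "\<sigma> \<in> enriched_partitions X v \<gamma>"
      using labeled_chain.enriched_partitions_nonempty[OF chain[OF vw(1)]] by blast
    ultimately show "v = w"
      using iff vw by metis
  qed
  have "?c w \<simeq> B \<longleftrightarrow> enriched_crystal X w \<gamma> \<simeq> B" if w: "w \<in> ?L" for w
  proof -
    note ops = enriched_crystal_linear_extension_f[OF P w]
    show ?thesis
      by (rule iffI; erule crystal_iso_cong[rotated -1])
        (simp_all add: enriched_crystal_simps enriched_crystal_eps_phi ops)
  qed
  then have eq: "{K \<in> crystal_components ?E. K \<simeq> B} = ?c ` {w \<in> ?L. enriched_crystal X w \<gamma> \<simeq> B}"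
    unfolding crystal_components_enriched_crystal[OF P] by blast
  \<comment> \<open>Finiteness rules out the value \<infinity> of
    \<open>multiplicity\<close>.\<close>
  have "?L \<subseteq> Pow (X \<times> X)"
    by (auto simp: linear_extensions_def linear_order_on_def partial_order_on_def preorder_on_def)
  moreover have "finite X"
    using P by (simp add: labeled_poset_def)
  ultimately have "finite ?L"
    by (meson finite_Pow_iff finite_SigmaI finite_subset)
  then show ?thesis
    unfolding multiplicity_def Let_def eq
    using card_image[OF inj_on_subset[OF inj, of "{w \<in> ?L. enriched_crystal X w \<gamma> \<simeq> B}"]] by simp
qed

section \<open>Quasi-ribbon tableaux\<close>

definition ribbon_order :: "nat list \<Rightarrow> (nat \<times> nat) rel" where
  "ribbon_order \<alpha> = {(x, y) \<in> ribbon \<alpha> \<times> ribbon \<alpha>. fst x \<le> fst y \<and> snd x \<le> snd y}"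

text \<open>A positional encoding whose base exceeds every column number, so the row dominates:
  labels decrease from row to row downwards and increase to the right within a row. Decreasing
  labels thus give the reading order of tableaux, and the last \<open>Suc\<close> makes labels
  positive.\<close>

definition ribbon_label :: "nat list \<Rightarrow> nat \<times> nat \<Rightarrow> nat" where
  "ribbon_label \<alpha> x = (length \<alpha> - fst x) * Suc (Max (snd ` ribbon \<alpha>)) + Suc (snd x)"

lemma row_start_0 [simp]: "row_start \<alpha> 0 = 0"
  by (simp add: row_start_def)

lemma row_start_Suc: "row_start \<alpha> (Suc i) = row_start \<alpha> i + (\<alpha> ! i - 1)"
  by (simp add: row_start_def)

lemma row_start_mono: "i \<le> k \<Longrightarrow> row_start \<alpha> i \<le> row_start \<alpha> k"
  by (rule lift_Suc_mono_le) (simp_all add: row_start_Suc)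

lemma ribbon_eq_Sigma: "ribbon \<alpha> = (SIGMA i:{..<length \<alpha>}. {row_start \<alpha> i..<row_start \<alpha> i + \<alpha> ! i})"
  by (auto simp: ribbon_def)

lemma finite_ribbon [simp]: "finite (ribbon \<alpha>)"
  by (simp add: ribbon_eq_Sigma)

lemma ribbon_label_less:
  assumes "(i, j) \<in> ribbon \<alpha>" "(i', j') \<in> ribbon \<alpha>" "i < i'"
  shows "ribbon_label \<alpha> (i', j') < ribbon_label \<alpha> (i, j)"
proof -
  let ?N = "Suc (Max (snd ` ribbon \<alpha>))"
  have "j' \<in> snd ` ribbon \<alpha>"
    using assms(2) by force
  then have "j' < ?N"
    by (simp add: le_imp_less_Suc)
  then have "(length \<alpha> - i') * ?N + Suc j' \<le> Suc (length \<alpha> - i') * ?N"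
    by simp
  also have "\<dots> \<le> (length \<alpha> - i) * ?N"
    using assms by (intro mult_le_mono1) (auto simp: ribbon_def)
  finally show ?thesis
    by (simp add: ribbon_label_def)
qed

lemma ribbon_label_row_less_iff [simp]: "ribbon_label \<alpha> (i, j) < ribbon_label \<alpha> (i, j') \<longleftrightarrow> j < j'"
  by (simp add: ribbon_label_def)

text \<open>For a composition and \<open>i\<close> up to its length this is the sum of the first
  \<open>i\<close> parts, the number of nodes above row \<open>i\<close>. Written this way it is
  strictly increasing for every list.\<close>

definition row_offset :: "nat list \<Rightarrow> nat \<Rightarrow> nat" where
  "row_offset \<alpha> i = i + row_start \<alpha> i"

lemma strict_mono_row_offset: "strict_mono (row_offset \<alpha>)"
  by (simp add: strict_mono_Suc_iff row_offset_def row_start_Suc)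

locale ribbon_shape =
  fixes \<alpha> :: "nat list"
  assumes comp: "composition \<alpha>"
begin

lemma pos: "i < length \<alpha> \<Longrightarrow> 0 < \<alpha> ! i"
  using comp by (simp add: composition_def)

lemma row_end:
  assumes "i < length \<alpha>"
  shows "(i, row_start \<alpha> (Suc i)) \<in> ribbon \<alpha>" "(i, row_start \<alpha> i) \<in> ribbon \<alpha>"
    "(i, j) \<in> ribbon \<alpha> \<Longrightarrow> j \<le> row_start \<alpha> (Suc i)"
  using pos[OF assms] assms by (auto simp: ribbon_def row_start_Suc)

text \<open>Row \<open>i\<close> ends in column \<open>row_start \<alpha> (Suc i)\<close>, where the
  next row begins, so lower rows never reach to the left of it.\<close>

lemma ribbon_row_less:
  assumes "(i, j) \<in> ribbon \<alpha>" "(i', j') \<in> ribbon \<alpha>" "i < i'"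
  shows "j \<le> row_start \<alpha> (Suc i)" "row_start \<alpha> (Suc i) \<le> row_start \<alpha> i'" "row_start \<alpha> i' \<le> j'"
proof -
  show "j \<le> row_start \<alpha> (Suc i)"
    using assms(1) by (intro row_end(3)) (auto simp: ribbon_def)
  show "row_start \<alpha> (Suc i) \<le> row_start \<alpha> i'"
    using assms(3) by (intro row_start_mono) simp
  show "row_start \<alpha> i' \<le> j'"
    using assms(2) by (simp add: ribbon_def)
qed

text \<open>A node in a lower row lies weakly to the right, so on a ribbon the componentwise order
  compares any two nodes.\<close>

lemma ribbon_order_cases:
  assumes "x \<in> ribbon \<alpha>" "y \<in> ribbon \<alpha>"
  obtains "x = y" | "fst x < fst y" "(x, y) \<in> ribbon_order \<alpha>" | "fst x = fst y" "snd x < snd y" "(x, y) \<in> ribbon_order \<alpha>"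
    | "fst y < fst x" "(y, x) \<in> ribbon_order \<alpha>" | "fst y = fst x" "snd y < snd x" "(y, x) \<in> ribbon_order \<alpha>"
proof -
  have less: "(x, y) \<in> ribbon_order \<alpha>" if "x \<in> ribbon \<alpha>" "y \<in> ribbon \<alpha>" "fst x < fst y" for x y
    using that ribbon_row_less[of "fst x" "snd x" "fst y" "snd y"] by (auto simp: ribbon_order_def)
  show thesis
    using that less assms
    by (cases "fst x" "fst y" rule: linorder_cases; cases "snd x" "snd y" rule: linorder_cases)
      (auto simp: ribbon_order_def prod_eq_iff)
qed

lemma linear_order_on_ribbon_order: "linear_order_on (ribbon \<alpha>) (ribbon_order \<alpha>)"
  unfolding linear_order_on_def partial_order_on_def preorder_on_def
proof (intro conjI)
  show "total_on (ribbon \<alpha>) (ribbon_order \<alpha>)"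
    unfolding total_on_def by (metis ribbon_order_cases)
qed (auto simp: ribbon_order_def refl_on_def trans_def antisym_def)

lemma labeled_chain_ribbon: "labeled_chain (ribbon \<alpha>) (ribbon_order \<alpha>) (ribbon_label \<alpha>)"
proof
  show "linear_order_on (ribbon \<alpha>) (ribbon_order \<alpha>)"
    by (rule linear_order_on_ribbon_order)
  have "inj_on (ribbon_label \<alpha>) (ribbon \<alpha>)"
  proof (rule inj_onI)
    fix x y
    assume xy: "x \<in> ribbon \<alpha>" "y \<in> ribbon \<alpha>" "ribbon_label \<alpha> x = ribbon_label \<alpha> y"
    obtain i j i' j' where eq: "x = (i, j)" "y = (i', j')"
      by (cases x, cases y)
    show "x = y"
      using xy ribbon_label_less[of i j \<alpha> i' j'] ribbon_label_less[of i' j' \<alpha> i j]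
        ribbon_label_row_less_iff[of \<alpha> i j j'] ribbon_label_row_less_iff[of \<alpha> i j' j]
      unfolding eq by (cases i i' rule: linorder_cases; cases j j' rule: linorder_cases) auto
  qed
  then show "labeled_poset (ribbon \<alpha>) (ribbon_order \<alpha>) (ribbon_label \<alpha>)"
    using linear_order_on_ribbon_order
    by (simp add: labeled_poset_def linear_order_on_def ribbon_label_def)
qed

text \<open>Tableaux restrict pairs within one row or column, enriched partitions all comparable
  pairs. The gap is closed by walking along the ribbon: each descent to the next row is strict at
  even values, so equality across rows leaves only odd ones.\<close>

lemma quasi_ribbon_row_step:
  assumes T: "T \<in> quasi_ribbon_tableaux \<alpha>" and "(i, j) \<in> ribbon \<alpha>" "(i', j') \<in> ribbon \<alpha>" "i < i'"
  shows "T (i, j) < T (i', j') \<or> T (i, j) = T (i', j') \<and> odd_half (T (i, j))"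
  using assms(2-)
proof (induction i' arbitrary: j')
  case (Suc k)
  have row: "T (a, b) \<le> T (a, b')" if "(a, b) \<in> ribbon \<alpha>" "(a, b') \<in> ribbon \<alpha>" "b \<le> b'" for a b b'
    using T that by (cases "b = b'") (auto simp: quasi_ribbon_tableaux_def)
  have step: "T (k, b) < T (Suc k, j') \<or> T (k, b) = T (Suc k, j') \<and> odd_half (T (k, b))"
    if b: "(k, b) \<in> ribbon \<alpha>" for b
  proof -
    \<comment> \<open>The column shared by rows \<open>k\<close> and \<open>Suc k\<close>; the walk
      goes right to it, down, and right again.\<close>
    let ?e = "row_start \<alpha> (Suc k)"
    have k: "k < length \<alpha>" "Suc k < length \<alpha>"
      using b Suc.prems(2) by (auto simp: ribbon_def)
    have e: "(k, ?e) \<in> ribbon \<alpha>" "(Suc k, ?e) \<in> ribbon \<alpha>"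
      using row_end(1)[OF k(1)] row_end(2)[OF k(2)] .
    have "T (k, b) \<le> T (k, ?e)"
      by (rule row[OF b e(1) row_end(3)[OF k(1) b]])
    moreover have "T (k, ?e) \<le> T (Suc k, ?e)" "even_half (T (k, ?e)) \<Longrightarrow> T (k, ?e) < T (Suc k, ?e)"
      using T e by (auto simp: quasi_ribbon_tableaux_def)
    moreover have "T (Suc k, ?e) \<le> T (Suc k, j')"
      using Suc.prems(2) by (intro row e) (auto simp: ribbon_def)
    ultimately show ?thesis
      by (metis order_le_less order_less_le_trans order_le_less_trans)
  qed
  show ?case
  proof (cases "i = k")
    case True
    with step Suc.prems show ?thesis by blast
  next
    case False
    have k: "(k, row_start \<alpha> k) \<in> ribbon \<alpha>"
      using Suc.prems(2) by (intro row_end(2)) (auto simp: ribbon_def)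
    then have "T (i, j) < T (k, row_start \<alpha> k) \<or> T (i, j) = T (k, row_start \<alpha> k) \<and> odd_half (T (i, j))"
      using Suc.IH Suc.prems False by auto
    with step[OF k] show ?thesis
      by auto
  qed
qed simp

text \<open>Labels increase along rows, so repetitions there are even; labels decrease from row to
  row, so repetitions there are odd. These are the two strictness conditions of a quasi-ribbon
  tableau.\<close>

lemma quasi_ribbon_tableaux_eq:
  "quasi_ribbon_tableaux \<alpha> = enriched_partitions (ribbon \<alpha>) (ribbon_order \<alpha>) (ribbon_label \<alpha>)"
proof (intro equalityI subsetI)
  fix T
  assume T: "T \<in> quasi_ribbon_tableaux \<alpha>"
  show "T \<in> enriched_partitions (ribbon \<alpha>) (ribbon_order \<alpha>) (ribbon_label \<alpha>)"
    unfolding mem_enriched_partitions_iff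
  proof (intro conjI allI impI)
    show "T \<in> ribbon \<alpha> \<rightarrow>\<^sub>E UNIV"
      using T by (simp add: quasi_ribbon_tableaux_def)
    fix x y
    assume xy: "(x, y) \<in> ribbon_order \<alpha> \<and> x \<noteq> y"
    obtain i j i' j' where eq: "x = (i, j)" "y = (i', j')"
      by (cases x, cases y)
    with xy have mem: "(i, j) \<in> ribbon \<alpha>" "(i', j') \<in> ribbon \<alpha>" "i \<le> i'" "j \<le> j'"
      by (auto simp: ribbon_order_def)
    show "enriched_less (ribbon_label \<alpha>) T x y"
    proof (cases "i = i'")
      case True
      with xy mem eq have "j < j'"
        by auto
      moreover from this have "T (i, j) \<le> T (i, j')" "odd_half (T (i, j)) \<Longrightarrow> T (i, j) < T (i, j')"
        using T mem True by (auto simp: quasi_ribbon_tableaux_def)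
      ultimately show ?thesis
        unfolding eq True[symmetric] by (auto simp: enriched_less_def)
    next
      case False
      with mem have "i < i'"
        by simp
      then show ?thesis
        using quasi_ribbon_row_step[OF T mem(1,2)] ribbon_label_less[OF mem(1,2)]
        unfolding eq by (auto simp: enriched_less_def)
    qed
  qed
next
  fix T
  assume T: "T \<in> enriched_partitions (ribbon \<alpha>) (ribbon_order \<alpha>) (ribbon_label \<alpha>)"
  then have less: "enriched_less (ribbon_label \<alpha>) T x y" if "(x, y) \<in> ribbon_order \<alpha>" "x \<noteq> y" for x y
    using that unfolding mem_enriched_partitions_iff by blast
  show "T \<in> quasi_ribbon_tableaux \<alpha>"
    unfolding quasi_ribbon_tableaux_def mem_Collect_eq
  proof (intro conjI allI impI; (elim conjE)?)
    show "T \<in> ribbon \<alpha> \<rightarrow>\<^sub>E UNIV"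
      using T by (simp add: mem_enriched_partitions_iff)
    fix i j j'
    assume "(i, j) \<in> ribbon \<alpha>" "(i, j') \<in> ribbon \<alpha>" "j < j'"
    then have "enriched_less (ribbon_label \<alpha>) T (i, j) (i, j')" "\<not> ribbon_label \<alpha> (i, j') < ribbon_label \<alpha> (i, j)"
      by (auto simp: ribbon_order_def intro!: less)
    then show "T (i, j) \<le> T (i, j')" "odd_half (T (i, j)) \<Longrightarrow> T (i, j) < T (i, j')"
      by (auto simp: enriched_less_def)
  next
    fix i i' j
    assume mem: "(i, j) \<in> ribbon \<alpha>" "(i', j) \<in> ribbon \<alpha>" "i < i'"
    then have "enriched_less (ribbon_label \<alpha>) T (i, j) (i', j)"
      by (auto simp: ribbon_order_def intro!: less)
    then show "T (i, j) \<le> T (i', j)" "even_half (T (i, j)) \<Longrightarrow> T (i, j) < T (i', j)"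
      using ribbon_label_less[OF mem] by (auto simp: enriched_less_def)
  qed
qed

text \<open>The reading list is the only enumeration with decreasing labels, so it is enough that
  the nodes, row by row and right to left, have decreasing labels. The induction adds one row at a
  time.\<close>

lemma tableau_word_eq: "tableau_word \<alpha> = partition_word (ribbon \<alpha>) (ribbon_label \<alpha>)"
proof
  fix T
  let ?row = "\<lambda>i. map (Pair i) (rev [row_start \<alpha> i..<row_start \<alpha> i + \<alpha> ! i])"
  let ?r = "\<lambda>x y. ribbon_label \<alpha> y < ribbon_label \<alpha> x"
  have row: "sorted_wrt ?r (?row i)" for i
    by (simp add: sorted_wrt_map sorted_wrt_rev)
  have "sorted_wrt ?r (concat (map ?row [0..<m]))" if "m \<le> length \<alpha>" for m
    using that
  proof (induction m)
    case (Suc m)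
    have "?r x y" if "x \<in> set (concat (map ?row [0..<m]))" "y \<in> set (?row m)" for x y
    proof -
      have m: "m < length \<alpha>"
        using Suc.prems by simp
      from that(1) obtain i where i: "i < m" "x \<in> set (?row i)"
        by auto
      with m obtain j where "x = (i, j)" "(i, j) \<in> ribbon \<alpha>"
        by (auto simp: ribbon_def)
      moreover from that(2) m obtain j' where "y = (m, j')" "(m, j') \<in> ribbon \<alpha>"
        by (auto simp: ribbon_def)
      ultimately show ?thesis
        using ribbon_label_less i(1) by blast
    qed
    then show ?case
      using Suc row[of m] by (simp add: sorted_wrt_append del: set_concat set_map set_rev)
  qed simp
  then have "reading_list (ribbon \<alpha>) (ribbon_label \<alpha>) = concat (map ?row [0..<length \<alpha>])"
    by (intro reading_list_unique) (auto simp: ribbon_eq_Sigma)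
  then show "tableau_word \<alpha> T = partition_word (ribbon \<alpha>) (ribbon_label \<alpha>) T"
    by (simp add: tableau_word_def partition_word_reading_list map_concat comp_def)
qed

lemma quasi_ribbon_crystal_eq:
  "quasi_ribbon_crystal \<alpha> = enriched_crystal (ribbon \<alpha>) (ribbon_order \<alpha>) (ribbon_label \<alpha>)"
  by (simp add: quasi_ribbon_crystal_def enriched_crystal_def quasi_ribbon_tableaux_eq tableau_word_eq)

section \<open>Positions and descents along the ribbon\<close>

lemma row_offset_Suc: "i < length \<alpha> \<Longrightarrow> row_offset \<alpha> (Suc i) = row_offset \<alpha> i + \<alpha> ! i"
  using pos[of i] by (simp add: row_offset_def row_start_Suc)

text \<open>The node \<open>(i, j)\<close> is the \<open>(i + j)\<close>-th one along the ribbon.\<close>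

lemma bij_betw_position: "bij_betw (\<lambda>(i, j). i + j) (ribbon \<alpha>) {..<row_offset \<alpha> (length \<alpha>)}"
  unfolding bij_betw_def
proof (intro conjI equalityI subsetI)
  show "inj_on (\<lambda>(i, j). i + j) (ribbon \<alpha>)"
  proof (rule inj_onI)
    fix x y
    assume "x \<in> ribbon \<alpha>" "y \<in> ribbon \<alpha>" "(case x of (i, j) \<Rightarrow> i + j) = (case y of (i, j) \<Rightarrow> i + j)"
    then show "x = y"
      by (cases rule: ribbon_order_cases[of x y]) (auto simp: ribbon_order_def split: prod.splits)
  qed
next
  fix p
  assume "p \<in> (\<lambda>(i, j). i + j) ` ribbon \<alpha>"
  then obtain i j where p: "p = i + j" "(i, j) \<in> ribbon \<alpha>"
    by auto
  then have i: "i < length \<alpha>"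
    by (simp add: ribbon_def)
  then have "p < row_offset \<alpha> (Suc i)"
    using p by (simp add: row_offset_Suc) (simp add: row_offset_def ribbon_def)
  also have "\<dots> \<le> row_offset \<alpha> (length \<alpha>)"
    using strict_mono_row_offset i by (simp add: strict_mono_less_eq)
  finally show "p \<in> {..<row_offset \<alpha> (length \<alpha>)}"
    by simp
next
  fix p
  assume "p \<in> {..<row_offset \<alpha> (length \<alpha>)}"
  then have p: "p < row_offset \<alpha> (length \<alpha>)"
    by simp
  \<comment> \<open>The first row offset beyond \<open>p\<close>; since
    \<open>row_offset \<alpha> 0\<close> is 0, \<open>m\<close> is positive, and position
    \<open>p\<close> lies in row \<open>m - 1\<close>.\<close>
  define m where "m = (LEAST m. p < row_offset \<alpha> m)"
  have m: "p < row_offset \<alpha> m" "m \<le> length \<alpha>"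
    unfolding m_def using p by (auto intro: LeastI Least_le)
  moreover have "m \<noteq> 0"
    using m(1) by (cases m) (auto simp: row_offset_def)
  ultimately obtain i where i: "m = Suc i" "i < length \<alpha>" "p < row_offset \<alpha> (Suc i)"
    by (metis Suc_le_lessD not0_implies_Suc)
  have "\<not> p < row_offset \<alpha> i"
    using i(1) not_less_Least[of i "\<lambda>m. p < row_offset \<alpha> m"] by (simp add: m_def)
  with i have "(i, p - i) \<in> ribbon \<alpha>" "i \<le> p"
    by (auto simp: ribbon_def row_offset_Suc) (auto simp: row_offset_def)
  then show "p \<in> (\<lambda>(i, j). i + j) ` ribbon \<alpha>"
    by (intro image_eqI[of _ _ "(i, p - i)"]) auto
qed

lemma card_ribbon: "card (ribbon \<alpha>) = row_offset \<alpha> (length \<alpha>)"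
  using bij_betw_same_card[OF bij_betw_position] by simp

text \<open>The sum of the coordinates increases strictly along the ribbon order and runs
  bijectively through an initial segment, so it is the list position of the node.\<close>

lemma nth_order_list_ribbon:
  assumes "(i, j) \<in> ribbon \<alpha>"
  shows "order_list (ribbon \<alpha>) (ribbon_order \<alpha>) ! (i + j) = (i, j)"
proof -
  let ?pos = "\<lambda>(i, j). i + j :: nat" and ?N = "row_offset \<alpha> (length \<alpha>)"
  let ?node = "inv_into (ribbon \<alpha>) ?pos"
  note bij = bij_betw_position
  have node: "?node p \<in> ribbon \<alpha>" "?pos (?node p) = p" if "p < ?N" for p
    using bij_betw_apply[OF bij_betw_inv_into[OF bij], of p] bij_betw_inv_into_right[OF bij, of p] that
    by auto
  have "order_list (ribbon \<alpha>) (ribbon_order \<alpha>) = map ?node [0..<?N]"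
  proof (rule order_list_eqI[OF linear_order_on_ribbon_order])
    show "distinct (map ?node [0..<?N])"
      using bij_betw_imp_inj_on[OF bij_betw_inv_into[OF bij]]
      by (simp add: distinct_map lessThan_atLeast0)
    show "set (map ?node [0..<?N]) = ribbon \<alpha>"
      using bij_betw_imp_surj_on[OF bij_betw_inv_into[OF bij]] by (simp add: lessThan_atLeast0)
    have "(?node p, ?node q) \<in> ribbon_order \<alpha>" if "p < q" "q < ?N" for p q
    proof -
      have p: "p < ?N"
        using that by simp
      show ?thesis
        by (rule ribbon_order_cases[OF node(1)[OF p] node(1)[OF that(2)]])
          (use node(2)[OF p] node(2)[OF that(2)] that(1) in \<open>auto simp: ribbon_order_def split: prod.splits\<close>)
    qed
    then show "sorted_wrt (\<lambda>x y. (x, y) \<in> ribbon_order \<alpha>) (map ?node [0..<?N])"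
      by (auto simp: sorted_wrt_iff_nth_less)
  qed
  moreover have "i + j < ?N"
    using bij_betw_apply[OF bij assms] by simp
  moreover have "?node (i + j) = (i, j)"
    using bij_betw_inv_into_left[OF bij assms] by simp
  ultimately show ?thesis
    by simp
qed

text \<open>Consecutive nodes lie either in one row, where the label rises, or on both sides of a
  row break, where it falls. So the descents are the offsets of all rows but the first.\<close>

lemma descents_ribbon:
  "descents (ribbon \<alpha>) (ribbon_order \<alpha>) (ribbon_label \<alpha>) = row_offset \<alpha> ` {1..<length \<alpha>}"
proof (intro equalityI subsetI)
  fix p
  assume "p \<in> descents (ribbon \<alpha>) (ribbon_order \<alpha>) (ribbon_label \<alpha>)"
  then have p: "1 \<le> p" "p < row_offset \<alpha> (length \<alpha>)"
    and label: "ribbon_label \<alpha> (order_list (ribbon \<alpha>) (ribbon_order \<alpha>) ! p) <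
      ribbon_label \<alpha> (order_list (ribbon \<alpha>) (ribbon_order \<alpha>) ! (p - 1))"
    by (auto simp: descents_def card_ribbon)
  have "\<exists>i j. (i, j) \<in> ribbon \<alpha> \<and> q = i + j" if "q < row_offset \<alpha> (length \<alpha>)" for q
  proof -
    have "q \<in> (\<lambda>(i, j). i + j) ` ribbon \<alpha>"
      using that by (simp add: bij_betw_imp_surj_on[OF bij_betw_position])
    then show ?thesis
      by auto
  qed
  then obtain i j i' j' where x: "(i, j) \<in> ribbon \<alpha>" "p - 1 = i + j" and y: "(i', j') \<in> ribbon \<alpha>" "p = i' + j'"
    using p by (metis less_imp_diff_less)
  have less: "ribbon_label \<alpha> (i', j') < ribbon_label \<alpha> (i, j)"
    using label unfolding x(2) nth_order_list_ribbon[OF x(1)] unfolding y(2) nth_order_list_ribbon[OF y(1)] .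
  have "i \<noteq> i'"
    using less x(2) y(2) p(1) by auto
  moreover have "\<not> i' < i"
    using less ribbon_label_less[OF y(1) x(1)] by auto
  ultimately have "i < i'"
    by simp
  note row = ribbon_row_less[OF x(1) y(1) this]
  \<comment> \<open>The coordinate sums differ by one and \<open>i < i'\<close> already uses up this
    difference. So the columns agree, and every inequality in \<open>row\<close> is an
    equality.\<close>
  have "j' = row_start \<alpha> i'"
    using row x(2) y(2) p(1) \<open>i < i'\<close> by linarith
  then have "p = row_offset \<alpha> i'"
    using y(2) by (simp add: row_offset_def)
  moreover have "i' \<in> {1..<length \<alpha>}"
    using \<open>i < i'\<close> y(1) by (simp add: ribbon_def)
  ultimately show "p \<in> row_offset \<alpha> ` {1..<length \<alpha>}"
    by blast
next
  fix p
  assume "p \<in> row_offset \<alpha> ` {1..<length \<alpha>}"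
  then obtain m where m: "p = row_offset \<alpha> (Suc m)" "Suc m < length \<alpha>"
    by (auto simp: Suc_le_eq gr0_conv_Suc)
  have mem: "(m, row_start \<alpha> (Suc m)) \<in> ribbon \<alpha>" "(Suc m, row_start \<alpha> (Suc m)) \<in> ribbon \<alpha>"
    using row_end(1)[of m] row_end(2)[OF m(2)] m(2) by simp_all
  have p: "p = Suc m + row_start \<alpha> (Suc m)" "p - 1 = m + row_start \<alpha> (Suc m)"
    using m(1) by (simp_all add: row_offset_def)
  have "p < row_offset \<alpha> (length \<alpha>)"
    unfolding m(1) using strict_monoD[OF strict_mono_row_offset m(2)] .
  moreover have "ribbon_label \<alpha> (order_list (ribbon \<alpha>) (ribbon_order \<alpha>) ! p) <
      ribbon_label \<alpha> (order_list (ribbon \<alpha>) (ribbon_order \<alpha>) ! (p - 1))"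
    unfolding p(2) nth_order_list_ribbon[OF mem(1)]
    unfolding p(1) nth_order_list_ribbon[OF mem(2)]
    by (rule ribbon_label_less[OF mem]) simp
  ultimately show "p \<in> descents (ribbon \<alpha>) (ribbon_order \<alpha>) (ribbon_label \<alpha>)"
    using p by (simp add: descents_def card_ribbon)
qed

text \<open>The parts are the differences of consecutive row offsets. The leading 0 in
  \<open>composition_of\<close> is the offset of the first row, and the final entry is the number of
  nodes.\<close>

lemma composition_of_ribbon:
  "composition_of (card (ribbon \<alpha>)) (descents (ribbon \<alpha>) (ribbon_order \<alpha>) (ribbon_label \<alpha>)) = \<alpha>"
proof (cases "\<alpha> = []")
  case True
  then show ?thesis
    by (simp add: composition_of_def ribbon_def)
next
  case False
  let ?o = "row_offset \<alpha>" and ?n = "length \<alpha>"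
  have "sorted_wrt (<) (map ?o [1..<?n])"
    using strict_mono_row_offset by (auto simp: sorted_wrt_iff_nth_less strict_mono_less)
  then have sorted: "sorted_list_of_set (?o ` {1..<?n}) = map ?o [1..<?n]"
    by (intro sorted_distinct_set_unique) (auto simp: strict_sorted_iff)
  have o0: "?o 0 = 0"
    by (simp add: row_offset_def)
  have "?o ?n \<noteq> 0"
    using False by (simp add: row_offset_def)
  then have "composition_of (card (ribbon \<alpha>)) (descents (ribbon \<alpha>) (ribbon_order \<alpha>) (ribbon_label \<alpha>)) =
      map2 (\<lambda>a b. b - a) (0 # map ?o [1..<?n]) (map ?o [1..<?n] @ [?o ?n])"
    by (simp add: composition_of_def card_ribbon descents_ribbon sorted del: One_nat_def)
  also have "0 # map ?o [1..<?n] = map ?o [0..<?n]"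
    using False o0 by (simp add: upt_conv_Cons)
  also have "map ?o [1..<?n] @ [?o ?n] = map ?o [1..<Suc ?n]"
    using False by (simp add: Suc_leI)
  also have "map2 (\<lambda>a b. b - a) (map ?o [0..<?n]) (map ?o [1..<Suc ?n]) = \<alpha>"
    by (intro nth_equalityI) (auto simp: row_offset_Suc simp del: upt_Suc)
  finally show ?thesis .
qed

end

text \<open>The start 0 is generalized to \<open>a\<close> so that the induction can move along the
  list. Sortedness matters because subtraction of natural numbers truncates.\<close>

lemma map2_diff_inject:
  fixes a r r' :: nat
  assumes "map2 (\<lambda>a b. b - a) (a # l) (l @ [r]) = map2 (\<lambda>a b. b - a) (a # l') (l' @ [r'])"
    and "sorted (a # l @ [r])" "sorted (a # l' @ [r'])"
  shows "l = l' \<and> r = r'"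
  using assms
proof (induction l arbitrary: a l')
  case Nil
  then show ?case
    by (cases l') auto
next
  case (Cons x l)
  then obtain y m where l': "l' = y # m"
    by (cases l') auto
  from Cons.prems have "x = y"
    by (auto simp: l')
  with Cons.prems Cons.IH[of x m] show ?case
    by (auto simp: l')
qed

lemma composition_of_inject:
  assumes "S \<subseteq> {1..<r}" "S' \<subseteq> {1..<r'}" "composition_of r S = composition_of r' S'"
  shows "r = r' \<and> S = S'"
proof -
  have fin: "finite S" "finite S'"
    using assms(1,2) finite_subset by blast+
  \<comment> \<open>For positive \<open>n\<close> the result has one entry more than
    \<open>sorted_list_of_set U\<close>, so an empty composition detects
    \<open>n = 0\<close>.\<close>
  have nonempty: "composition_of n U = [] \<longleftrightarrow> n = 0" for n U
    by (cases "sorted_list_of_set U") (simp_all add: composition_of_def)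
  show ?thesis
  proof (cases "r = 0")
    case True
    then have "r' = 0"
      using assms(3) nonempty by metis
    with True assms show ?thesis
      by simp
  next
    case False
    then have "r' \<noteq> 0"
      using assms(3) nonempty by metis
    have sorted: "sorted (0 # sorted_list_of_set U @ [n])" if "U \<subseteq> {1..<n}" for U and n :: nat
    proof -
      have "finite U" "\<forall>x\<in>U. x \<le> n"
        using that finite_subset[OF that] by auto
      then show ?thesis
        by (simp add: sorted_append)
    qed
    have "sorted_list_of_set S = sorted_list_of_set S' \<and> r = r'"
      by (rule map2_diff_inject[OF _ sorted[OF assms(1)] sorted[OF assms(2)]])
        (use assms(3) False \<open>r' \<noteq> 0\<close> in \<open>simp add: composition_of_def\<close>)
    then show ?thesis
      using fin sorted_list_of_set_inject by blast
  qed
qed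

theorem corollary4p4:
  fixes X :: "'a set" and r :: "'a rel" and \<gamma> :: "'a \<Rightarrow> nat"
  assumes "labeled_poset X r \<gamma>"
  shows "enriched_crystal X r \<gamma> \<simeq>
           crystal_sum (linear_extensions X r) (\<lambda>w. enriched_crystal X w \<gamma>) \<and>
         (\<forall>\<alpha>. composition \<alpha> \<longrightarrow>
           multiplicity (quasi_ribbon_crystal \<alpha>) (enriched_crystal X r \<gamma>) =
           enat (card {w \<in> linear_extensions X r.
                         composition_of (card X) (descents X w \<gamma>) = \<alpha>}))"
proof (intro conjI allI impI)
  show "enriched_crystal X r \<gamma> \<simeq>
      crystal_sum (linear_extensions X r) (\<lambda>w. enriched_crystal X w \<gamma>)"
    by (rule enriched_crystal_iso_crystal_sum[OF assms])
next
  fix \<alpha>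
  assume "composition \<alpha>"
  then interpret A: ribbon_shape \<alpha>
    by unfold_locales
  let ?D = "descents (ribbon \<alpha>) (ribbon_order \<alpha>) (ribbon_label \<alpha>)"
  have "enriched_crystal X w \<gamma> \<simeq> quasi_ribbon_crystal \<alpha> \<longleftrightarrow>
      composition_of (card X) (descents X w \<gamma>) = \<alpha>" if "w \<in> linear_extensions X r" for w
  proof -
    have "labeled_chain X w \<gamma>"
      using linear_extensions_labeled_poset[OF assms that] by unfold_locales
    then have "enriched_crystal X w \<gamma> \<simeq> quasi_ribbon_crystal \<alpha> \<longleftrightarrow>
        card X = card (ribbon \<alpha>) \<and> descents X w \<gamma> = ?D"
      unfolding A.quasi_ribbon_crystal_eq by (rule enriched_chain_iso_iff[OF _ A.labeled_chain_ribbon])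
    \<comment> \<open>The size and descent set of the ribbon yield \<alpha> itself, so injectivity
      of \<open>composition_of\<close> turns the two equations into one.\<close>
    also have "\<dots> \<longleftrightarrow> composition_of (card X) (descents X w \<gamma>) = \<alpha>"
      using composition_of_inject[OF descents_subset descents_subset] A.composition_of_ribbon by metis
    finally show ?thesis .
  qed
  then show "multiplicity (quasi_ribbon_crystal \<alpha>) (enriched_crystal X r \<gamma>) =
      enat (card {w \<in> linear_extensions X r. composition_of (card X) (descents X w \<gamma>) = \<alpha>})"
    unfolding multiplicity_enriched_crystal[OF assms] by (metis (no_types, lifting))
qed

end
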